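(* Let $\mathfrak{H}$ and $\mathfrak{H}_n$, $n\in\mathbb{N}$, be separable Hilbert spaces, let $J_n\in\mathcal{B}(\mathfrak{H},\mathfrak{H}_n)$ be bounded operators, and let $A$ in $\mathfrak{H}$ and $A_n$ in $\mathfrak{H}_n$ be self-adjoint operators. Suppose $A_n$ converges to $A$ in generalized strong resolvent sense. If $\lambda_0<\lambda_1$ are real numbers with $P_A(\{\lambda_0\})=P_A(\{\lambda_1\})=0$, then $$\operatorname*{s-lim}_{n\to\infty}J_n^*P_{A_n}((\lambda_0,\lambda_1))J_n=\operatorname*{s-lim}_{n\to\infty}J_n^*P_{A_n}([\lambda_0,\lambda_1])J_n=P_A((\lambda_0,\lambda_1))=P_A([\lambda_0,\lambda_1]).$$ Moreover, $$\dim\operatorname{Ran}P_A((\lambda_0,\lambda_1))\le\liminf_{n\to\infty}\dim\operatorname{Ran}J_n^*P_{A_n}((\lambda_0,\lambda_1))J_n\le\limsup_{n\to\infty}\|J_n\|^2\,\liminf_{n\to\infty}\dim\operatorname{Ran}P_{A_n}((\lambda_0,\lambda_1)).$$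
   Context: $P_A(\Omega)$ denotes the spectral projection of the self-adjoint operator $A$ for the Borel set $\Omega\subseteq\mathbb{R}$; s-lim denotes the strong limit; dimensions take values in $\{0,1,2,\dots\}\cup\{\infty\}$. $R_A(z)=(A-z)^{-1}$ and $\Gamma:=\mathbb{C}\setminus\overline{\sigma(A)\cup\bigcup_n\sigma(A_n)}$. Generalized strong resolvent convergence of $A_n$ to $A$ means: $\|J_n\|\le C$ for some constant $C>0$ and all $n$, $\|J_n^*J_n\psi-\psi\|\to0$ for all $\psi\in\mathfrak{H}$, and $\lim_{n\to\infty}\|J_n^*R_{A_n}(z)J_n\psi-R_A(z)\psi\|=0$ for all $\psi\in\mathfrak{H}$, for one $z\in\Gamma$.
   Formalization: Resolvent convergence is assumed at one nonreal z in Γ rather than at an arbitrary z in Γ; for a real z the statement is false (A = 1 on ℂ, A_n the inverse of the matrix with rows (1,1/2),(1/2,1) on ℂ², J_n the first-coordinate embedding, z = 0). *)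

theory Defs
  imports "HOL-Analysis.Analysis"
begin

text \<open>
  Complex Hilbert spaces are real Hilbert spaces with a compatible complex structure. The inner
  product is conjugate linear in the first and linear in the second argument; its real part
  is the inner product of \<^class>\<open>real_inner\<close>, so norm and topology are the library ones.
\<close>

class complex_inner = real_inner +
  fixes scaleC :: "complex \<Rightarrow> 'a \<Rightarrow> 'a" (infixr "*\<^sub>C" 75)
    and cinner :: "'a \<Rightarrow> 'a \<Rightarrow> complex"
  assumes scaleC_add_right: "a *\<^sub>C (x + y) = a *\<^sub>C x + a *\<^sub>C y"
    and scaleC_add_left: "(a + b) *\<^sub>C x = a *\<^sub>C x + b *\<^sub>C x"
    and scaleC_scaleC: "a *\<^sub>C (b *\<^sub>C x) = (a * b) *\<^sub>C x"
    and scaleC_of_real: "complex_of_real r *\<^sub>C x = r *\<^sub>R x"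
    and cinner_commute: "cinner x y = cnj (cinner y x)"
    and cinner_add_right: "cinner x (y + z) = cinner x y + cinner x z"
    and cinner_scaleC_right: "cinner x (a *\<^sub>C y) = a * cinner x y"
    and Re_cinner: "Re (cinner x y) = inner x y"

class complex_hilbert = complex_inner + complete_space

lemma vector_space_scaleC:
  "vector_space (scaleC :: complex \<Rightarrow> 'a \<Rightarrow> 'a::complex_inner)"
proof
  fix x :: 'a
  show "1 *\<^sub>C x = x" using scaleC_of_real[of 1 x] by simp
qed (simp_all add: scaleC_add_right scaleC_add_left scaleC_scaleC)

text \<open>
  A sequence of Hilbert spaces, which may differ from member to member, cannot be a sequence of
  types. Its members are closed complex subspaces of one Hilbert space type. This is no
  restriction, as every sequence of Hilbert spaces embeds into its Hilbert direct sum.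
  All notions below are therefore relative to such a subspace \<open>H\<close>.
\<close>

definition hilbert_subspace :: "'a::complex_hilbert set \<Rightarrow> bool" where
  "hilbert_subspace H \<longleftrightarrow> module.subspace scaleC H \<and> closed H"

definition separable_hilbert :: "'a::complex_hilbert set \<Rightarrow> bool" where
  "separable_hilbert H \<longleftrightarrow> hilbert_subspace H \<and> separable_space (top_of_set H)"

definition cdim :: "'a::complex_inner set \<Rightarrow> enat" where
  "cdim S = (if \<exists>B. finite B \<and> S \<subseteq> module.span scaleC B
             then enat (vector_space.dim scaleC S) else \<infinity>)"

definition bounded_clinear :: "('a::complex_inner \<Rightarrow> 'b::complex_inner) \<Rightarrow> bool" where
  "bounded_clinear T \<longleftrightarrow> bounded_linear T \<and> (\<forall>a x. T (a *\<^sub>C x) = a *\<^sub>C T x)"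

text \<open>
  For \<open>T\<close> with values in a closed subspace \<open>K\<close>, the restriction of \<open>cadjoint T\<close> to \<open>K\<close>
  is the adjoint of \<open>T\<close> regarded as an operator into \<open>K\<close>.
\<close>

definition cadjoint ::
    "('a::complex_hilbert \<Rightarrow> 'b::complex_hilbert) \<Rightarrow> 'b \<Rightarrow> 'a" where
  "cadjoint T = (THE S. \<forall>x y. cinner (T x) y = cinner x (S y))"

definition strong_limit ::
    "(nat \<Rightarrow> 'a \<Rightarrow> 'a::real_normed_vector) \<Rightarrow> ('a \<Rightarrow> 'a) \<Rightarrow> bool" where
  "strong_limit T S \<longleftrightarrow> (\<forall>\<psi>. (\<lambda>n. T n \<psi>) \<longlonglongrightarrow> S \<psi>)"

text \<open>Unbounded operators are partial functions; \<open>dom A\<close> is the domain of the operator.\<close>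

definition linear_operator_in ::
    "'a::complex_hilbert set \<Rightarrow> ('a \<rightharpoonup> 'a) \<Rightarrow> bool" where
  "linear_operator_in H A \<longleftrightarrow>
     dom A \<subseteq> H \<and> ran A \<subseteq> H \<and> module.subspace scaleC (dom A) \<and>
     (\<forall>x\<in>dom A. \<forall>y\<in>dom A. the (A (x + y)) = the (A x) + the (A y)) \<and>
     (\<forall>a. \<forall>x\<in>dom A. the (A (a *\<^sub>C x)) = a *\<^sub>C the (A x))"

definition operator_adjoint ::
    "'a::complex_hilbert set \<Rightarrow> ('a \<rightharpoonup> 'a) \<Rightarrow> ('a \<rightharpoonup> 'a)" where
  "operator_adjoint H A y =
     (if y \<in> H \<and> (\<exists>z\<in>H. \<forall>x\<in>dom A. cinner (the (A x)) y = cinner x z)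
      then Some (THE z. z \<in> H \<and> (\<forall>x\<in>dom A. cinner (the (A x)) y = cinner x z))
      else None)"

definition self_adjoint_in ::
    "'a::complex_hilbert set \<Rightarrow> ('a \<rightharpoonup> 'a) \<Rightarrow> bool" where
  "self_adjoint_in H A \<longleftrightarrow>
     linear_operator_in H A \<and> H \<subseteq> closure (dom A) \<and> operator_adjoint H A = A"

definition resolvent_set ::
    "'a::complex_hilbert set \<Rightarrow> ('a \<rightharpoonup> 'a) \<Rightarrow> complex set" where
  "resolvent_set H A =
     {z. bij_betw (\<lambda>x. the (A x) - z *\<^sub>C x) (dom A) H \<and>
         (\<exists>C. \<forall>x\<in>dom A. norm x \<le> C * norm (the (A x) - z *\<^sub>C x))}"

definition spectrum ::
    "'a::complex_hilbert set \<Rightarrow> ('a \<rightharpoonup> 'a) \<Rightarrow> complex set" where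
  "spectrum H A = - resolvent_set H A"

definition resolvent :: "('a::complex_hilbert \<rightharpoonup> 'a) \<Rightarrow> complex \<Rightarrow> 'a \<Rightarrow> 'a" where
  "resolvent A z = inv_into (dom A) (\<lambda>x. the (A x) - z *\<^sub>C x)"

definition orthogonal_projection_in ::
    "'a::complex_hilbert set \<Rightarrow> ('a \<Rightarrow> 'a) \<Rightarrow> bool" where
  "orthogonal_projection_in H P \<longleftrightarrow>
     (\<forall>x\<in>H. P x \<in> H) \<and>
     (\<forall>x\<in>H. \<forall>y\<in>H. P (x + y) = P x + P y) \<and>
     (\<forall>a. \<forall>x\<in>H. P (a *\<^sub>C x) = a *\<^sub>C P x) \<and>
     (\<forall>x\<in>H. P (P x) = P x) \<and>
     (\<forall>x\<in>H. \<forall>y\<in>H. cinner (P x) y = cinner x (P y))"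

definition projection_valued_measure ::
    "'a::complex_hilbert set \<Rightarrow> (real set \<Rightarrow> 'a \<Rightarrow> 'a) \<Rightarrow> bool" where
  "projection_valued_measure H P \<longleftrightarrow>
     (\<forall>\<Omega>\<in>sets borel. orthogonal_projection_in H (P \<Omega>)) \<and>
     (\<forall>x\<in>H. P UNIV x = x) \<and>
     (\<forall>\<Omega> :: nat \<Rightarrow> real set. range \<Omega> \<subseteq> sets borel \<longrightarrow> disjoint_family \<Omega> \<longrightarrow>
        (\<forall>x\<in>H. (\<lambda>k. P (\<Omega> k) x) sums P (\<Union>k. \<Omega> k) x))"

definition scalar_spectral_measure ::
    "(real set \<Rightarrow> 'a \<Rightarrow> 'a::complex_hilbert) \<Rightarrow> 'a \<Rightarrow> real measure" where
  "scalar_spectral_measure P \<psi> =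
     measure_of UNIV (sets borel) (\<lambda>\<Omega>. ennreal (Re (cinner \<psi> (P \<Omega> \<psi>))))"

text \<open>
  \<open>P\<close> is the family of spectral projections of \<open>A\<close>, that is, \<open>A\<close> is the integral of
  \<open>t\<close> with respect to \<open>P\<close>: the domain of \<open>A\<close> consists of the vectors \<open>\<psi>\<close> in \<open>H\<close> for which
  \<open>t\<^sup>2\<close> is integrable with respect to the scalar measure of \<open>\<psi>\<close>, and on it the quadratic form of
  \<open>A\<close> is the integral of \<open>t\<close>. By polarization these two conditions determine \<open>A\<close>; by the
  spectral theorem every self-adjoint \<open>A\<close> has exactly one such \<open>P\<close> (on Borel sets and \<open>H\<close>).
\<close>

definition spectral_projections_of ::
    "'a::complex_hilbert set \<Rightarrow> ('a \<rightharpoonup> 'a) \<Rightarrow> (real set \<Rightarrow> 'a \<Rightarrow> 'a) \<Rightarrow> bool" where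
  "spectral_projections_of H A P \<longleftrightarrow>
     projection_valued_measure H P \<and>
     dom A = {\<psi>\<in>H. (\<integral>\<^sup>+t. ennreal (t\<^sup>2) \<partial>scalar_spectral_measure P \<psi>) < \<infinity>} \<and>
     (\<forall>\<psi>\<in>dom A. cinner \<psi> (the (A \<psi>)) =
        complex_of_real (\<integral>t. t \<partial>scalar_spectral_measure P \<psi>))"

definition common_resolvent_set ::
    "('a::complex_hilbert \<rightharpoonup> 'a) \<Rightarrow> (nat \<Rightarrow> 'b::complex_hilbert set) \<Rightarrow>
     (nat \<Rightarrow> 'b \<rightharpoonup> 'b) \<Rightarrow> complex set" where
  "common_resolvent_set A H\<^sub>n A\<^sub>n =
     - closure (spectrum UNIV A \<union> (\<Union>n. spectrum (H\<^sub>n n) (A\<^sub>n n)))"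

text \<open>
  The point \<open>z\<close> is required to be nonreal. A real \<open>z\<close> is not enough: for the isometry \<open>J\<close>
  from \<open>\<complex>\<close> onto the first coordinate of \<open>\<complex>\<^sup>2\<close>, \<open>A = 1\<close> and all \<open>A\<^sub>n\<close> equal to the inverse of
  the matrix with rows \<open>(1, 1/2)\<close> and \<open>(1/2, 1)\<close>, the compressed resolvents at \<open>z = 0\<close> coincide
  with that of \<open>A\<close>, but the spectrum of \<open>A\<^sub>n\<close> is \<open>{2/3, 2}\<close>, so that the spectral projections
  of \<open>A\<^sub>n\<close> for small intervals around 1 vanish.
\<close>

definition generalized_strong_resolvent_convergence ::
    "(nat \<Rightarrow> 'b::complex_hilbert set) \<Rightarrow> (nat \<Rightarrow> 'a::complex_hilbert \<Rightarrow> 'b) \<Rightarrow>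
     (nat \<Rightarrow> 'b \<rightharpoonup> 'b) \<Rightarrow> ('a \<rightharpoonup> 'a) \<Rightarrow> bool" where
  "generalized_strong_resolvent_convergence H\<^sub>n J A\<^sub>n A \<longleftrightarrow>
     (\<exists>C>0. \<forall>n. onorm (J n) \<le> C) \<and>
     (\<forall>\<psi>. (\<lambda>n. norm (cadjoint (J n) (J n \<psi>) - \<psi>)) \<longlonglongrightarrow> 0) \<and>
     (\<exists>z\<in>common_resolvent_set A H\<^sub>n A\<^sub>n. Im z \<noteq> 0 \<and>
        (\<forall>\<psi>. (\<lambda>n. norm (cadjoint (J n) (resolvent (A\<^sub>n n) z (J n \<psi>)) - resolvent A z \<psi>))
                \<longlonglongrightarrow> 0))"

end

theory Submission
  imports Defs
begin

text \<open>
  Expanding \<open>\<parallel>J\<^sub>n R \<psi> - R\<^sub>n J\<^sub>n \<psi>\<parallel>\<^sup>2\<close> shows that \<open>J\<^sub>n\<close> asymptotically intertwines the resolvents at the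
  nonreal point \<open>z\<close>. No functional calculus is needed to pass from there to spectral projections: for
  suitable \<open>w\<close> near \<open>z\<close> the Moebius function \<open>(t - w) / (t - z)\<close> has modulus at most \<open>\<kappa>\<close> exactly on
  \<open>[\<lambda>\<^sub>0, \<lambda>\<^sub>1]\<close>, or exactly off \<open>(\<lambda>\<^sub>0, \<lambda>\<^sub>1)\<close>. Applying it many times to \<open>A\<close> and to \<open>A\<^sub>n\<close> and comparing
  growth rates shows that a vector in the range of \<open>P\<^sub>A\<close> of a set at positive distance from
  \<open>[\<lambda>\<^sub>0, \<lambda>\<^sub>1]\<close>, or of a closed set inside \<open>(\<lambda>\<^sub>0, \<lambda>\<^sub>1)\<close>, is asymptotically mapped by \<open>J\<^sub>n\<close> to the
  corresponding side for \<open>A\<^sub>n\<close>; such vectors span a dense subspace as the endpoints are not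
  eigenvalues. The first dimension bound is the lower semicontinuity of the rank; the second holds
  because \<open>J\<^sub>n\<^sup>* J\<^sub>n \<rightarrow> 1\<close> forces \<open>limsup \<parallel>J\<^sub>n\<parallel>\<^sup>2 \<ge> 1\<close> unless the space is trivial.
\<close>

section \<open>Complex inner product spaces\<close>

interpretation complex_vec: vector_space "scaleC :: complex \<Rightarrow> 'a \<Rightarrow> 'a::complex_inner"
  by (rule vector_space_scaleC)

lemma cinner_scaleC_left: "cinner (a *\<^sub>C x) y = cnj a * cinner x y"
  using cinner_commute[of "a *\<^sub>C x" y] cinner_commute[of x y]
  by (simp add: cinner_scaleC_right)

lemma cinner_add_left: "cinner (x + y) z = cinner x z + cinner y z"
  using cinner_commute[of "x + y" z] cinner_commute[of x z] cinner_commute[of y z]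
  by (simp add: cinner_add_right)

lemma cinner_zero_right [simp]: "cinner x 0 = 0"
  using cinner_add_right[of x 0 0] by simp

lemma cinner_zero_left [simp]: "cinner 0 x = 0"
  using cinner_add_left[of 0 0 x] by simp

lemma cinner_minus_right: "cinner x (- y) = - cinner x y"
  using cinner_add_right[of x y "- y"] by (simp add: add_eq_0_iff)

lemma cinner_minus_left: "cinner (- x) y = - cinner x y"
  using cinner_add_left[of x "- x" y] by (simp add: add_eq_0_iff)

lemma cinner_diff_right: "cinner x (y - z) = cinner x y - cinner x z"
  using cinner_add_right[of x y "- z"] by (simp add: cinner_minus_right)

lemma cinner_diff_left: "cinner (x - y) z = cinner x z - cinner y z"
  using cinner_add_left[of x "- y" z] by (simp add: cinner_minus_left)

lemma cinner_sum_right: "cinner x (\<Sum>i\<in>I. f i) = (\<Sum>i\<in>I. cinner x (f i))"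
  by (induction I rule: infinite_finite_induct) (auto simp: cinner_add_right)

lemma cinner_self: "cinner x x = complex_of_real ((norm x)\<^sup>2)"
proof (rule complex_eqI)
  show "Re (cinner x x) = Re (complex_of_real ((norm x)\<^sup>2))"
    by (simp add: Re_cinner power2_norm_eq_inner)
  have "Im (cinner x x) = - Im (cinner x x)"
    using arg_cong[OF cinner_commute[of x x], of Im] by simp
  then show "Im (cinner x x) = Im (complex_of_real ((norm x)\<^sup>2))" by simp
qed

lemma norm_scaleC: "norm (a *\<^sub>C x) = cmod a * norm x"
proof -
  have "complex_of_real ((norm (a *\<^sub>C x))\<^sup>2) = cnj a * (a * complex_of_real ((norm x)\<^sup>2))"
    by (simp only: cinner_self[symmetric] cinner_scaleC_left cinner_scaleC_right mult.left_commute)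
  also have "\<dots> = complex_of_real ((cmod a * norm x)\<^sup>2)"
    unfolding power_mult_distrib of_real_mult complex_norm_square[of a] by (simp add: mult_ac)
  finally have "(norm (a *\<^sub>C x))\<^sup>2 = (cmod a * norm x)\<^sup>2"
    by (simp only: of_real_eq_iff)
  then show ?thesis by (simp add: power2_eq_iff_nonneg)
qed

lemma cinner_Cauchy_Schwarz: "cmod (cinner x y) \<le> norm x * norm y"
proof (cases "cinner x y = 0")
  case False
  define u where "u = cnj (cinner x y) / complex_of_real (cmod (cinner x y))"
  have "cmod u = 1" using False by (simp add: u_def norm_divide)
  have "u * cinner x y = complex_of_real (cmod (cinner x y))"
    using False complex_norm_square[of "cinner x y"]
    by (simp add: u_def field_simps power2_eq_square)
  then have "cmod (cinner x y) = Re (cinner x (u *\<^sub>C y))"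
    by (simp add: cinner_scaleC_right)
  also have "\<dots> \<le> norm x * norm (u *\<^sub>C y)"
    unfolding Re_cinner by (rule norm_cauchy_schwarz)
  finally show ?thesis using \<open>cmod u = 1\<close> by (simp add: norm_scaleC)
qed simp

lemma bounded_linear_cinner_right: "bounded_linear (cinner x)"
proof (rule bounded_linear_intro[where K = "norm x"])
  show "cinner x (r *\<^sub>R y) = r *\<^sub>R cinner x y" for r y
    by (simp add: scaleC_of_real[symmetric] cinner_scaleC_right scaleR_conv_of_real)
qed (use cinner_Cauchy_Schwarz[of x] in \<open>auto simp: cinner_add_right mult.commute\<close>)

lemma tendsto_cinner_right: "(f \<longlongrightarrow> l) F \<Longrightarrow> ((\<lambda>n. cinner x (f n)) \<longlongrightarrow> cinner x l) F"
  by (rule bounded_linear.tendsto[OF bounded_linear_cinner_right])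

lemma Im_cinner_conv_Re: "Im (cinner x y) = Re (cinner (\<i> *\<^sub>C x) y)"
  by (simp add: cinner_scaleC_left)

lemma norm_diff_square: "(norm (x - y))\<^sup>2 = (norm x)\<^sup>2 - 2 * Re (cinner x y) + (norm y)\<^sup>2"
  for x y :: "'a::complex_inner"
  by (simp add: Re_cinner power2_norm_eq_inner inner_diff inner_commute)

text \<open>Polarization: \<open>x + w\<close> makes \<open>h\<close> antisymmetric, and
  \<open>w = \<i> *\<^sub>C y\<close> turns antisymmetry into symmetry because \<open>h\<close> is
  conjugate linear in one argument only. It is stated on a subspace \<open>D\<close> so that it
  applies to forms defined only on an operator domain.\<close>

lemma sesquilinear_zero:
  fixes h :: "'a::complex_inner \<Rightarrow> 'a \<Rightarrow> complex"
  assumes D: "complex_vec.subspace D"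
    and add_left: "\<And>x y w. x \<in> D \<Longrightarrow> y \<in> D \<Longrightarrow> w \<in> D \<Longrightarrow> h (x + y) w = h x w + h y w"
    and add_right: "\<And>x y w. x \<in> D \<Longrightarrow> y \<in> D \<Longrightarrow> w \<in> D \<Longrightarrow> h w (x + y) = h w x + h w y"
    and scale_left: "\<And>a x w. x \<in> D \<Longrightarrow> w \<in> D \<Longrightarrow> h (a *\<^sub>C x) w = cnj a * h x w"
    and scale_right: "\<And>a x w. x \<in> D \<Longrightarrow> w \<in> D \<Longrightarrow> h w (a *\<^sub>C x) = a * h w x"
    and zero: "\<And>x. x \<in> D \<Longrightarrow> h x x = 0"
    and x: "x \<in> D" and y: "y \<in> D"
  shows "h x y = 0"
proof -
  have iy: "\<i> *\<^sub>C y \<in> D" using D y by (simp add: complex_vec.subspace_scale)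
  have polar: "h x w + h w x = 0" if w: "w \<in> D" for w
  proof -
    have "x + w \<in> D" using D x w by (rule complex_vec.subspace_add)
    then have "h (x + w) (x + w) = h x x + h w x + (h x w + h w w)"
      using x w by (simp only: add_left add_right)
    then show ?thesis using zero[of "x + w"] zero[OF x] zero[OF w] \<open>x + w \<in> D\<close>
      by (simp add: add.commute)
  qed
  have "\<i> * (h x y - h y x) = 0"
    using polar[OF iy] x y by (simp add: scale_left scale_right algebra_simps)
  moreover have "h x y + h y x = 0" using polar[OF y] .
  ultimately show ?thesis by simp
qed

section \<open>Adjoints\<close>

text \<open>For \<open>c > b\<close> and \<open>c > 0\<close> the quadratic is negative at
  \<open>t = - a / c\<close> unless \<open>a = 0\<close>. This is the first-order condition at a
  minimiser.\<close>

lemma quadratic_nonneg_imp_linear_zero: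
  fixes a b :: real
  assumes "\<And>t. 0 \<le> 2 * t * a + t\<^sup>2 * b"
  shows "a = 0"
proof (rule ccontr)
  assume "a \<noteq> 0"
  define c where "c = \<bar>b\<bar> + 1"
  have c: "c > 0" "b < c" by (auto simp: c_def)
  have "2 * (- a / c) * a + (- a / c)\<^sup>2 * b = (a\<^sup>2 / c) * (b / c - 2)"
    using c by (simp add: field_simps power2_eq_square)
  moreover have "(a\<^sup>2 / c) * (b / c - 2) < 0"
  proof (rule mult_pos_neg)
    have "b / c < 1" using c by simp
    then show "b / c - 2 < 0" by linarith
  qed (use c \<open>a \<noteq> 0\<close> in auto)
  ultimately show False using assms[of "- a / c"] by linarith
qed

text \<open>The representing vector is the minimiser of \<open>\<parallel>x\<parallel>\<^sup>2 - 2 f x\<close>; minimising sequences are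
  Cauchy by the parallelogram law.\<close>

theorem Riesz_representation:
  fixes f :: "'a::{real_inner,complete_space} \<Rightarrow> real"
  assumes f: "bounded_linear f"
  obtains v where "\<And>x. f x = inner x v"
proof -
  interpret f: bounded_linear f by fact
  define g where "g x = (norm x)\<^sup>2 - 2 * f x" for x
  obtain K where K: "\<And>x. \<bar>f x\<bar> \<le> norm x * K" using f.bounded by auto
  \<comment> \<open>\<open>g x\<close> is at least \<open>(norm x)\<^sup>2 - 2 * K * norm x\<close>;
    completing the square gives the bound.\<close>
  have lower: "- K\<^sup>2 \<le> g x" for x
  proof -
    have "0 \<le> (norm x - K)\<^sup>2" by simp
    then show ?thesis using K[of x] by (simp add: g_def power2_eq_square algebra_simps)
  qed
  define I where "I = (INF x. g x)"
  have bdd: "bdd_below (range g)" using lower by (meson bdd_below.I2)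
  have I: "I \<le> g x" for x unfolding I_def by (rule cINF_lower[OF bdd]) simp
  have "\<exists>x. g x < I + 1 / Suc n" for n
  proof -
    have "I < I + 1 / Suc n" by simp
    then show ?thesis unfolding I_def using cINF_less_iff[OF UNIV_not_empty bdd, of "Inf (range g) + 1 / Suc n"] by auto
  qed
  then obtain X where X: "\<And>n. g (X n) < I + 1 / Suc n" by metis
  have parallelogram: "(norm (x - y))\<^sup>2 = 2 * g x + 2 * g y - 4 * g ((1/2) *\<^sub>R (x + y))" for x y
  proof -
    have "(norm ((1/2) *\<^sub>R (x + y)))\<^sup>2 = ((norm x)\<^sup>2 + 2 * inner x y + (norm y)\<^sup>2) / 4"
      unfolding power2_norm_eq_inner by (simp add: inner_simps inner_commute[of y x] field_simps)
    moreover have "f ((1/2) *\<^sub>R (x + y)) = (f x + f y) / 2" by (simp only: f.add f.scaleR) simp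
    moreover have "(norm (x - y))\<^sup>2 = (norm x)\<^sup>2 - 2 * inner x y + (norm y)\<^sup>2"
      unfolding power2_norm_eq_inner by (simp add: inner_simps inner_commute[of y x])
    ultimately show ?thesis unfolding g_def by (simp only:) argo
  qed
  have bound: "(norm (X i - X j))\<^sup>2 \<le> 2 / Suc i + 2 / Suc j" for i j
    using parallelogram[of "X i" "X j"] X[of i] X[of j] I[of "(1/2) *\<^sub>R (X i + X j)"] by linarith
  have "Cauchy X"
  proof (rule metric_CauchyI)
    fix e :: real assume "e > 0"
    then obtain N where N: "1 / Suc N < e\<^sup>2 / 4"
      using nat_approx_posE[of "e\<^sup>2 / 4"] by auto
    have "dist (X i) (X j) < e" if "i \<ge> N" "j \<ge> N" for i j
    proof -
      have "1 / Suc i \<le> 1 / Suc N" "1 / Suc j \<le> 1 / Suc N" using that by (auto simp: frac_le)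
      then have "(norm (X i - X j))\<^sup>2 < e\<^sup>2" using bound[of i j] N by linarith
      then show ?thesis using \<open>e > 0\<close> by (simp add: dist_norm power2_less_imp_less)
    qed
    then show "\<exists>N. \<forall>i\<ge>N. \<forall>j\<ge>N. dist (X i) (X j) < e" by blast
  qed
  then obtain v where v: "X \<longlonglongrightarrow> v" by (metis Cauchy_convergent convergentD)
  have "(\<lambda>n. g (X n)) \<longlonglongrightarrow> g v"
    unfolding g_def by (intro tendsto_intros v f.tendsto)
  moreover have "(\<lambda>n. I + 1 / Suc n) \<longlonglongrightarrow> I"
    using tendsto_add[OF tendsto_const[of I] LIMSEQ_inverse_real_of_nat]
    by (simp add: inverse_eq_divide add.commute)
  ultimately have "g v \<le> I"
    by (rule LIMSEQ_le) (use X in \<open>auto intro: less_imp_le\<close>)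
  have "f x = inner x v" for x
  proof -
    \<comment> \<open>This quadratic in \<open>t\<close> is
      \<open>g (v + t *\<^sub>R x) - g v\<close>, nonnegative by minimality, so its linear
      coefficient vanishes.\<close>
    have "0 \<le> 2 * t * (inner x v - f x) + t\<^sup>2 * (norm x)\<^sup>2" for t
    proof -
      have "g v \<le> g (v + t *\<^sub>R x)" using \<open>g v \<le> I\<close> I order_trans by blast
      moreover have "(norm (v + t *\<^sub>R x))\<^sup>2 = (norm v)\<^sup>2 + 2 * t * inner x v + t\<^sup>2 * (norm x)\<^sup>2"
        unfolding power2_norm_eq_inner
        by (simp add: inner_simps inner_commute[of v x] power2_eq_square algebra_simps)
      ultimately show ?thesis by (simp add: g_def f.add f.scaleR algebra_simps)
    qed
    from quadratic_nonneg_imp_linear_zero[OF this] show ?thesis by simp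
  qed
  then show thesis by (rule that)
qed

lemma cinner_eqI:
  assumes "\<And>x. cinner x y = cinner x y'"
  shows "y = y'"
proof -
  have "cinner (y - y') (y - y') = 0"
    using assms[of "y - y'"] by (simp add: cinner_diff_right)
  then show ?thesis by (simp add: cinner_self)
qed

text \<open>\<open>cadjoint\<close> is a definite description, so existence and uniqueness come
  first. Riesz represents the real part; the imaginary part follows because \<open>T\<close>
  commutes with multiplication by \<open>\<i>\<close>.\<close>

lemma cinner_cadjoint:
  fixes T :: "'a::complex_hilbert \<Rightarrow> 'b::complex_hilbert"
  assumes "bounded_clinear T"
  shows "cinner (T x) y = cinner x (cadjoint T y)"
proof -
  have bl: "bounded_linear T" and sc: "\<And>a x. T (a *\<^sub>C x) = a *\<^sub>C T x"
    using assms by (auto simp: bounded_clinear_def)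
  have "\<exists>v. \<forall>x. cinner (T x) y = cinner x v" for y
  proof -
    have "bounded_linear (\<lambda>x. inner (T x) y)"
      using bounded_linear_compose[OF bounded_linear_inner_left bl] by simp
    then obtain v where v: "\<And>x. inner (T x) y = inner x v" by (rule Riesz_representation) blast
    have "cinner (T x) y = cinner x v" for x
    proof (rule complex_eqI)
      show "Re (cinner (T x) y) = Re (cinner x v)" by (simp add: Re_cinner v)
      show "Im (cinner (T x) y) = Im (cinner x v)"
        unfolding Im_cinner_conv_Re sc[symmetric] by (simp add: Re_cinner v)
    qed
    then show ?thesis by blast
  qed
  then obtain S where S: "\<And>x y. cinner (T x) y = cinner x (S y)" by metis
  have "cadjoint T = S"
    unfolding cadjoint_def
  proof (rule the_equality)
    fix S' assume "\<forall>x y. cinner (T x) y = cinner x (S' y)"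
    then show "S' = S" by (intro ext cinner_eqI) (simp add: S[symmetric])
  qed (use S in blast)
  then show ?thesis using S by simp
qed

lemma cadjoint_add:
  assumes "bounded_clinear T"
  shows "cadjoint T (x + y) = cadjoint T x + cadjoint T y"
  by (rule cinner_eqI) (simp add: cinner_cadjoint[OF assms, symmetric] cinner_add_right)

lemma cadjoint_scaleC:
  assumes "bounded_clinear T"
  shows "cadjoint T (a *\<^sub>C x) = a *\<^sub>C cadjoint T x"
  by (rule cinner_eqI) (simp add: cinner_cadjoint[OF assms, symmetric] cinner_scaleC_right)

text \<open>Pair \<open>T\<close> applied to \<open>cadjoint T y\<close> with \<open>y\<close>, use
  Cauchy-Schwarz, and cancel one factor \<open>norm (cadjoint T y)\<close>.\<close>

lemma norm_cadjoint_le: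
  assumes T: "bounded_clinear T" and C: "\<And>x. norm (T x) \<le> C * norm x" and "0 \<le> C"
  shows "norm (cadjoint T y) \<le> C * norm y"
proof (cases "cadjoint T y = 0")
  case True
  then show ?thesis using \<open>0 \<le> C\<close> by simp
next
  case False
  let ?v = "cadjoint T y"
  have "(norm ?v)\<^sup>2 = Re (cinner (T ?v) y)"
    by (simp add: cinner_cadjoint[OF T] cinner_self)
  also have "\<dots> \<le> norm (T ?v) * norm y"
    unfolding Re_cinner by (rule norm_cauchy_schwarz)
  also have "\<dots> \<le> C * norm ?v * norm y"
    by (intro mult_right_mono C) simp
  finally show ?thesis using False by (simp add: power2_eq_square mult_ac)
qed

section \<open>Spectral projections of a self-adjoint operator\<close>

text \<open>Working relative to \<open>H\<close> lets the same facts serve the limit operator, with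
  \<open>H = UNIV\<close>, and every operator of the sequence in its own subspace.\<close>

locale spectral_operator =
  fixes H :: "'a::complex_hilbert set" and A :: "'a \<rightharpoonup> 'a" and P :: "real set \<Rightarrow> 'a \<Rightarrow> 'a"
  assumes hilbert: "hilbert_subspace H"
    and self_adjoint: "self_adjoint_in H A"
    and spectral: "spectral_projections_of H A P"
begin

abbreviation op :: "'a \<Rightarrow> 'a" where "op x \<equiv> the (A x)"

abbreviation \<mu> :: "'a \<Rightarrow> real measure" where "\<mu> \<equiv> scalar_spectral_measure P"

section \<open>Linearity and density of the domain\<close>

lemma subspace_H: "complex_vec.subspace H"
  using hilbert by (simp add: hilbert_subspace_def)

lemmas H_add = complex_vec.subspace_add[OF subspace_H]
  and H_diff = complex_vec.subspace_diff[OF subspace_H]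
  and H_scaleC = complex_vec.subspace_scale[OF subspace_H]
  and H_zero = complex_vec.subspace_0[OF subspace_H]

lemma linear_operator: "linear_operator_in H A"
  using self_adjoint by (simp add: self_adjoint_in_def)

lemma subspace_dom: "complex_vec.subspace (dom A)"
  using linear_operator by (simp add: linear_operator_in_def)

lemmas dom_add = complex_vec.subspace_add[OF subspace_dom]
  and dom_diff = complex_vec.subspace_diff[OF subspace_dom]
  and dom_scaleC = complex_vec.subspace_scale[OF subspace_dom]
  and dom_zero = complex_vec.subspace_0[OF subspace_dom]

lemma dom_H: "x \<in> dom A \<Longrightarrow> x \<in> H"
  using linear_operator by (auto simp: linear_operator_in_def)

lemma op_H: "x \<in> dom A \<Longrightarrow> op x \<in> H"
  using linear_operator by (auto simp: linear_operator_in_def ran_def)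

lemma op_add: "x \<in> dom A \<Longrightarrow> y \<in> dom A \<Longrightarrow> op (x + y) = op x + op y"
  using linear_operator by (simp add: linear_operator_in_def)

lemma op_scaleC: "x \<in> dom A \<Longrightarrow> op (a *\<^sub>C x) = a *\<^sub>C op x"
  using linear_operator by (simp add: linear_operator_in_def)

lemma dom_scaleR: "x \<in> dom A \<Longrightarrow> r *\<^sub>R x \<in> dom A"
  using dom_scaleC[of x "of_real r"] by (simp add: scaleC_of_real)

lemma op_scaleR: "x \<in> dom A \<Longrightarrow> op (r *\<^sub>R x) = r *\<^sub>R op x"
  using op_scaleC[of x "of_real r"] by (simp add: scaleC_of_real)

lemma op_diff: "x \<in> dom A \<Longrightarrow> y \<in> dom A \<Longrightarrow> op (x - y) = op x - op y"
  using op_add[of x "(-1) *\<^sub>R y"] dom_scaleR[of y "-1"] op_scaleR[of y "-1"] by simp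

lemma op_zero: "op 0 = 0"
  using op_scaleR[OF dom_zero, of 0] by simp

lemma closure_dom: "x \<in> H \<Longrightarrow> x \<in> closure (dom A)"
  using self_adjoint by (auto simp: self_adjoint_in_def)

lemma orthogonal_dom_imp_zero:
  assumes "y \<in> H" and "\<And>x. x \<in> dom A \<Longrightarrow> cinner x y = 0"
  shows "y = 0"
proof -
  obtain f where f: "\<And>n. f n \<in> dom A" "f \<longlonglongrightarrow> y"
    using closure_dom[OF \<open>y \<in> H\<close>] by (auto simp: closure_sequential)
  have "(\<lambda>n. cinner y (f n)) \<longlonglongrightarrow> cinner y y" by (rule tendsto_cinner_right[OF f(2)])
  moreover have "cinner y (f n) = 0" for n
    using assms(2)[OF f(1)[of n]] cinner_commute[of y "f n"] by simp
  ultimately have "cinner y y = 0" by (simp add: LIMSEQ_const_iff)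
  then show ?thesis by (simp add: cinner_self)
qed

section \<open>Calculus of the projection-valued measure\<close>

lemma pvm: "projection_valued_measure H P"
  using spectral by (simp add: spectral_projections_of_def)

lemma proj: "\<Omega> \<in> sets borel \<Longrightarrow> orthogonal_projection_in H (P \<Omega>)"
  using pvm by (simp add: projection_valued_measure_def)

lemma P_H: "\<Omega> \<in> sets borel \<Longrightarrow> x \<in> H \<Longrightarrow> P \<Omega> x \<in> H"
  using proj by (simp add: orthogonal_projection_in_def)

lemma P_add: "\<Omega> \<in> sets borel \<Longrightarrow> x \<in> H \<Longrightarrow> y \<in> H \<Longrightarrow> P \<Omega> (x + y) = P \<Omega> x + P \<Omega> y"
  using proj by (simp add: orthogonal_projection_in_def)

lemma P_scaleC: "\<Omega> \<in> sets borel \<Longrightarrow> x \<in> H \<Longrightarrow> P \<Omega> (a *\<^sub>C x) = a *\<^sub>C P \<Omega> x"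
  using proj by (simp add: orthogonal_projection_in_def)

lemma P_idem: "\<Omega> \<in> sets borel \<Longrightarrow> x \<in> H \<Longrightarrow> P \<Omega> (P \<Omega> x) = P \<Omega> x"
  using proj by (simp add: orthogonal_projection_in_def)

lemma P_self_adjoint:
  "\<Omega> \<in> sets borel \<Longrightarrow> x \<in> H \<Longrightarrow> y \<in> H \<Longrightarrow> cinner (P \<Omega> x) y = cinner x (P \<Omega> y)"
  using proj by (simp add: orthogonal_projection_in_def)

lemma P_diff: "\<Omega> \<in> sets borel \<Longrightarrow> x \<in> H \<Longrightarrow> y \<in> H \<Longrightarrow> P \<Omega> (x - y) = P \<Omega> x - P \<Omega> y"
  using P_add[of \<Omega> x "(-1) *\<^sub>C y"] P_scaleC[of \<Omega> y "-1"] H_scaleC[of y "-1"] by simp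

lemma P_UNIV: "x \<in> H \<Longrightarrow> P UNIV x = x"
  using pvm by (simp add: projection_valued_measure_def)

lemma P_sums:
  fixes F :: "nat \<Rightarrow> real set"
  assumes "range F \<subseteq> sets borel" "disjoint_family F" "x \<in> H"
  shows "(\<lambda>k. P (F k) x) sums P (\<Union>k. F k) x"
  using pvm assms unfolding projection_valued_measure_def by blast

lemma cinner_P: "\<Omega> \<in> sets borel \<Longrightarrow> x \<in> H \<Longrightarrow> cinner x (P \<Omega> x) = complex_of_real ((norm (P \<Omega> x))\<^sup>2)"
  using P_self_adjoint[of \<Omega> x "P \<Omega> x"] by (simp add: P_H P_idem cinner_self)

text \<open>The empty set is a countable disjoint union of copies of itself, and a convergent series
  with constant terms has zero terms.\<close>

lemma P_empty: assumes "x \<in> H" shows "P {} x = 0"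
proof -
  have "(\<lambda>k::nat. P {} x) sums P (\<Union>k::nat. {}) x"
    by (rule P_sums) (auto simp: assms disjoint_family_on_def)
  then have "(\<lambda>k::nat. P {} x) \<longlonglongrightarrow> 0" by (rule summable_LIMSEQ_zero[OF sums_summable])
  then show ?thesis by (simp add: LIMSEQ_const_iff)
qed

lemma P_Un:
  assumes S: "S \<in> sets borel" and T: "T \<in> sets borel" and "S \<inter> T = {}" and x: "x \<in> H"
  shows "P (S \<union> T) x = P S x + P T x"
proof -
  have "(\<lambda>k. P (binaryset S T k) x) sums P (\<Union>k. binaryset S T k) x"
    by (rule P_sums) (use assms in \<open>auto simp: range_binaryset_eq disjoint_family_on_def binaryset_def\<close>)
  moreover have "(\<lambda>k. P (binaryset S T k) x) sums (P S x + P T x)"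
    by (rule binaryset_sums) (rule P_empty[OF x])
  ultimately show ?thesis by (simp add: UN_binaryset_eq sums_unique2)
qed

lemma P_Compl: "S \<in> sets borel \<Longrightarrow> x \<in> H \<Longrightarrow> P (- S) x = x - P S x"
  using P_Un[of S "- S" x] P_UNIV[of x] by (simp add: Compl_partition borel_comp algebra_simps)

lemma norm_P_Pythagoras:
  assumes "S \<in> sets borel" "x \<in> H"
  shows "(norm x)\<^sup>2 = (norm (P S x))\<^sup>2 + (norm (P (- S) x))\<^sup>2"
proof -
  have "- S \<in> sets borel" using assms by (auto intro: borel_comp)
  have "cinner x x = cinner x (P S x) + cinner x (P (- S) x)"
    using assms by (simp add: P_Compl cinner_diff_right)
  also have "\<dots> = complex_of_real ((norm (P S x))\<^sup>2 + (norm (P (- S) x))\<^sup>2)"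
    unfolding of_real_add using assms \<open>- S \<in> sets borel\<close> by (simp only: cinner_P)
  finally show ?thesis unfolding cinner_self by (simp only: of_real_eq_iff)
qed

lemma norm_P_le: "S \<in> sets borel \<Longrightarrow> x \<in> H \<Longrightarrow> norm (P S x) \<le> norm x"
  by (rule power2_le_imp_le) (simp_all add: norm_P_Pythagoras[of S x])

text \<open>For \<open>y = P T x\<close>, additivity gives \<open>(norm (P (S \<union> T)
  y))\<^sup>2 = (norm (P S y))\<^sup>2 + (norm y)\<^sup>2\<close>, while a projection cannot
  increase the norm.\<close>

lemma P_disjoint:
  assumes S: "S \<in> sets borel" and T: "T \<in> sets borel" and "S \<inter> T = {}" and x: "x \<in> H"
  shows "P S (P T x) = 0"
proof -
  let ?y = "P T x"
  have y: "?y \<in> H" using T x by (rule P_H)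
  have ST: "S \<union> T \<in> sets borel" using S T by simp
  have "cinner ?y (P (S \<union> T) ?y) = cinner ?y (P S ?y) + cinner ?y (P T ?y)"
    using assms y by (simp add: P_Un cinner_add_right)
  then have "complex_of_real ((norm (P (S \<union> T) ?y))\<^sup>2)
      = complex_of_real ((norm (P S ?y))\<^sup>2 + (norm (P T ?y))\<^sup>2)"
    unfolding of_real_add using S T ST y by (simp only: cinner_P)
  then have "(norm (P (S \<union> T) ?y))\<^sup>2 = (norm (P S ?y))\<^sup>2 + (norm ?y)\<^sup>2"
    using P_idem[OF T x] by (simp only: of_real_eq_iff)
  moreover have "(norm (P (S \<union> T) ?y))\<^sup>2 \<le> (norm ?y)\<^sup>2"
    using norm_P_le[OF ST y] by (simp add: power_mono)
  ultimately show ?thesis by simp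
qed

text \<open>Multiplicativity is not part of \<open>projection_valued_measure\<close>. It follows by
  splitting \<open>T\<close> and then \<open>S\<close> along \<open>S \<inter> T\<close> and
  discarding the products over disjoint sets.\<close>

lemma P_Int:
  assumes S: "S \<in> sets borel" and T: "T \<in> sets borel" and x: "x \<in> H"
  shows "P S (P T x) = P (S \<inter> T) x"
proof -
  have I: "S \<inter> T \<in> sets borel" "T - S \<in> sets borel" "S - T \<in> sets borel" using S T by auto
  have "P T x = P (S \<inter> T) x + P (T - S) x"
    using P_Un[OF I(1,2) _ x] Int_Diff_Un[of T S]
    by (simp add: Int_commute[of T S] Diff_Int_distrib Int_Diff_disjoint disjoint_iff)
  then have "P S (P T x) = P S (P (S \<inter> T) x) + P S (P (T - S) x)"
    using S I x by (simp add: P_add P_H)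
  also have "P S (P (T - S) x) = 0" by (rule P_disjoint[OF S I(2) _ x]) auto
  also have "P S (P (S \<inter> T) x) = P ((S \<inter> T) \<union> (S - T)) (P (S \<inter> T) x)" by (simp add: Int_Diff_Un)
  also have "\<dots> = P (S \<inter> T) (P (S \<inter> T) x) + P (S - T) (P (S \<inter> T) x)"
    by (rule P_Un[OF I(1,3)]) (use I x in \<open>auto intro: P_H\<close>)
  also have "P (S - T) (P (S \<inter> T) x) = 0" by (rule P_disjoint[OF I(3,1) _ x]) auto
  finally show ?thesis using I x by (simp add: P_idem)
qed

lemma P_mono:
  assumes "S \<in> sets borel" "T \<in> sets borel" "S \<subseteq> T" "x \<in> H" "P S x = x"
  shows "P T x = x"
  using P_Int[of T S x] assms by (simp add: Int_absorb1)

lemma P_Compl_zero_iff: "S \<in> sets borel \<Longrightarrow> x \<in> H \<Longrightarrow> P (- S) x = 0 \<longleftrightarrow> P S x = x"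
  by (auto simp: P_Compl)

section \<open>Scalar spectral measures and their moments\<close>

lemma space_\<mu> [simp]: "space (\<mu> x) = UNIV"
  by (simp add: scalar_spectral_measure_def space_measure_of_conv)

lemma sets_\<mu> [simp, measurable_cong]: "sets (\<mu> x) = sets borel"
  unfolding scalar_spectral_measure_def
  using sets.sets_measure_of_eq[of borel] by simp

text \<open>\<open>measure_of\<close> returns the given set function only once countable additivity
  is shown; pairing the strongly convergent series of \<open>P_sums\<close> with \<open>x\<close>
  provides it.\<close>

lemma emeasure_\<mu>:
  assumes x: "x \<in> H" and S: "S \<in> sets borel"
  shows "emeasure (\<mu> x) S = ennreal ((norm (P S x))\<^sup>2)"
proof -
  have "emeasure (\<mu> x) S = ennreal (Re (cinner x (P S x)))"
  proof (rule emeasure_measure_of[OF scalar_spectral_measure_def])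
    show "positive (sets (\<mu> x)) (\<lambda>S. ennreal (Re (cinner x (P S x))))"
      using x by (simp add: positive_def P_empty)
    show "countably_additive (sets (\<mu> x)) (\<lambda>S. ennreal (Re (cinner x (P S x))))"
    proof (rule countably_additiveI)
      fix F :: "nat \<Rightarrow> real set"
      assume F: "range F \<subseteq> sets (\<mu> x)" "disjoint_family F"
      then have F': "F i \<in> sets borel" for i by auto
      have "(\<lambda>i. Re (cinner x (P (F i) x))) sums Re (cinner x (P (\<Union>i. F i) x))"
        by (intro sums_Re bounded_linear.sums[OF bounded_linear_cinner_right] P_sums)
           (use F x in auto)
      then show "(\<Sum>i. ennreal (Re (cinner x (P (F i) x)))) = ennreal (Re (cinner x (P (\<Union>i. F i) x)))"
        by (intro suminf_ennreal_eq) (simp_all add: cinner_P[OF F' x])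
    qed
  qed (use S in auto)
  then show ?thesis using S x by (simp add: cinner_P)
qed

lemma finite_measure_\<mu>: "x \<in> H \<Longrightarrow> finite_measure (\<mu> x)"
  by (rule finite_measureI) (simp add: emeasure_\<mu>)

lemma measure_\<mu>: "x \<in> H \<Longrightarrow> S \<in> sets borel \<Longrightarrow> measure (\<mu> x) S = (norm (P S x))\<^sup>2"
  by (simp add: measure_def emeasure_\<mu>)

lemma AE_\<mu>:
  assumes "x \<in> H" "S \<in> sets borel" "P S x = x"
  shows "AE t in \<mu> x. t \<in> S"
proof (rule AE_I)
  show "emeasure (\<mu> x) (- S) = 0"
    using assms P_Compl_zero_iff[of S x] by (simp add: emeasure_\<mu> borel_comp)
qed (use assms in \<open>auto intro: borel_comp\<close>)

lemma dom_iff: "x \<in> dom A \<longleftrightarrow> x \<in> H \<and> (\<integral>\<^sup>+t. ennreal (t\<^sup>2) \<partial>\<mu> x) < \<infinity>"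
  using spectral by (auto simp: spectral_projections_of_def)

lemma quadratic_form: "x \<in> dom A \<Longrightarrow> cinner x (op x) = complex_of_real (\<integral>t. t \<partial>\<mu> x)"
  using spectral by (simp add: spectral_projections_of_def)

text \<open>The measure is finite and has a second moment, so \<open>1 + t\<^sup>2\<close> is an
  integrable bound for \<open>\<bar>t\<bar>\<close>.\<close>

lemma integrable_\<mu>:
  assumes "x \<in> dom A" shows "integrable (\<mu> x) (\<lambda>t. t)"
proof -
  interpret finite_measure "\<mu> x" using assms dom_H by (blast intro: finite_measure_\<mu>)
  have "integrable (\<mu> x) (\<lambda>t. t\<^sup>2)"
    by (rule integrableI_nonneg) (use assms dom_iff in auto)
  then have "integrable (\<mu> x) (\<lambda>t. 1 + t\<^sup>2)" by simp
  then show ?thesis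
  proof (rule Bochner_Integration.integrable_bound)
    have "\<bar>t\<bar> \<le> 1 + t\<^sup>2" for t :: real
      using zero_le_power2[of "\<bar>t\<bar> - 1"] by (auto simp: power2_eq_square algebra_simps abs_if split: if_splits)
    then show "AE t in \<mu> x. norm t \<le> norm (1 + t\<^sup>2)" by simp
  qed simp
qed

text \<open>By \<open>P_Int\<close> both measures give a Borel set \<open>T\<close> the mass
  \<open>(norm (P (S \<inter> T) x))\<^sup>2\<close>.\<close>

lemma \<mu>_P:
  assumes x: "x \<in> H" and S: "S \<in> sets borel"
  shows "\<mu> (P S x) = density (\<mu> x) (indicator S)"
proof (rule measure_eqI)
  fix T assume "T \<in> sets (\<mu> (P S x))"
  then have T: "T \<in> sets borel" by simp
  have "emeasure (density (\<mu> x) (indicator S)) T = emeasure (\<mu> x) (S \<inter> T)"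
    using S T by (simp add: emeasure_density indicator_inter_arith[symmetric])
  then show "emeasure (\<mu> (P S x)) T = emeasure (density (\<mu> x) (indicator S)) T"
    using x S T by (simp add: emeasure_\<mu> P_H P_Int Int_commute)
qed simp

lemma P_dom:
  assumes x: "x \<in> dom A" and S: "S \<in> sets borel"
  shows "P S x \<in> dom A"
proof -
  have "(\<integral>\<^sup>+t. ennreal (t\<^sup>2) \<partial>\<mu> (P S x)) = (\<integral>\<^sup>+t. indicator S t * ennreal (t\<^sup>2) \<partial>\<mu> x)"
    unfolding \<mu>_P[OF dom_H[OF x] S] by (rule nn_integral_density) (use S in auto)
  also have "\<dots> \<le> (\<integral>\<^sup>+t. ennreal (t\<^sup>2) \<partial>\<mu> x)"
    by (rule nn_integral_mono) (auto simp: indicator_def)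
  finally show ?thesis using x S by (auto simp: dom_iff P_H intro: le_less_trans)
qed

text \<open>The quadratic form is an integral of \<open>t\<close>, hence real, and polarization
  makes the operator symmetric.\<close>

lemma op_symmetric:
  assumes "x \<in> dom A" "y \<in> dom A" shows "cinner (op x) y = cinner x (op y)"
proof -
  have "cinner x (op y) - cinner (op x) y = 0"
  proof (rule sesquilinear_zero[OF subspace_dom _ _ _ _ _ assms])
    fix x assume "x \<in> dom A"
    then show "cinner x (op x) - cinner (op x) x = 0"
      using cinner_commute[of "op x" x] by (simp add: quadratic_form)
  qed (simp_all add: op_add op_scaleC cinner_add_left cinner_add_right cinner_scaleC_left
      cinner_scaleC_right algebra_simps)
  then show ?thesis by simp
qed

lemma integral_P:
  assumes x: "x \<in> dom A" and S: "S \<in> sets borel"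
  shows "(\<integral>t. t \<partial>\<mu> (P S x)) = (\<integral>t. indicator S t * t \<partial>\<mu> x)"
proof -
  have "\<mu> (P S x) = density (\<mu> x) (\<lambda>t. ennreal (indicator S t))"
    unfolding \<mu>_P[OF dom_H[OF x] S] by (simp add: ennreal_indicator)
  then have "(\<integral>t. t \<partial>\<mu> (P S x)) = (\<integral>t. indicator S t *\<^sub>R t \<partial>\<mu> x)"
    using S by (simp add: integral_density)
  then show ?thesis by simp
qed

text \<open>The quadratic form of \<open>A\<close> splits along \<open>P S\<close>, hence by polarization so does the
  sesquilinear form, which makes \<open>P S\<close> reduce \<open>A\<close>.\<close>

lemma op_P:
  assumes x: "x \<in> dom A" and S: "S \<in> sets borel"
  shows "op (P S x) = P S (op x)"
proof -
  have S': "- S \<in> sets borel" using S by (rule borel_comp)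
  \<comment> \<open>\<open>h\<close> is the off-diagonal part of the form with respect to
    \<open>P S\<close> and \<open>P (- S)\<close>. It vanishes on the diagonal because the integral
    of \<open>t\<close> splits over \<open>S\<close> and its complement.\<close>
  define h where
    "h y x = cinner y (op x) - cinner (P S y) (op (P S x)) - cinner (P (- S) y) (op (P (- S) x))" for y x
  have h0: "h y x = 0" if "x \<in> dom A" "y \<in> dom A" for x y
  proof (rule sesquilinear_zero[OF subspace_dom _ _ _ _ _ that(2,1)])
    fix x assume x: "x \<in> dom A"
    have "(\<integral>t. t \<partial>\<mu> x) = (\<integral>t. indicator S t * t + indicator (- S) t * t \<partial>\<mu> x)"
      by (rule Bochner_Integration.integral_cong) (auto simp: indicator_def)
    also have "\<dots> = (\<integral>t. t \<partial>\<mu> (P S x)) + (\<integral>t. t \<partial>\<mu> (P (- S) x))"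
      unfolding integral_P[OF x S] integral_P[OF x S']
      using integrable_mult_indicator[OF _ integrable_\<mu>[OF x], of S]
        integrable_mult_indicator[OF _ integrable_\<mu>[OF x], of "- S"] S S'
      by (intro Bochner_Integration.integral_add) auto
    finally show "h x x = 0"
      unfolding h_def using x S S' by (simp add: quadratic_form P_dom)
  qed (use S S' in \<open>simp_all add: h_def op_add op_scaleC P_add P_scaleC P_dom dom_H cinner_add_left
      cinner_add_right cinner_scaleC_left cinner_scaleC_right algebra_simps\<close>)
  \<comment> \<open>At the arguments \<open>P T' y\<close> and \<open>P T x\<close> the two
    subtracted terms of \<open>h\<close> vanish by \<open>P_disjoint\<close>, so
    \<open>h = 0\<close> makes the vector orthogonal to the dense domain. The disjunction covers
    both orders of \<open>S\<close> and \<open>- S\<close>.\<close>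
  have cross: "P T' (op (P T x)) = 0"
    if T: "T \<in> sets borel" and T': "T' \<in> sets borel" "T' = - T" "T = S \<or> T' = S" for T T'
  proof (rule orthogonal_dom_imp_zero)
    show "P T' (op (P T x)) \<in> H" using T T' x by (simp add: P_H P_dom op_H)
    fix y assume y: "y \<in> dom A"
    have "cinner y (P T' (op (P T x))) = cinner (P T' y) (op (P T x))"
      using T T' x y by (simp add: P_self_adjoint P_dom op_H dom_H)
    moreover have "h (P T' y) (P T x) = cinner (P T' y) (op (P T x))"
    proof -
      have "P T (P T' y) = 0" by (rule P_disjoint[OF T T'(1)]) (use T'(2) dom_H[OF y] in auto)
      moreover have "P T' (P T x) = 0"
        by (rule P_disjoint[OF T'(1) T]) (use T'(2) dom_H[OF x] in auto)
      ultimately show ?thesis using T'(2,3) by (auto simp: h_def op_zero)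
    qed
    ultimately show "cinner y (P T' (op (P T x))) = 0"
      using h0[of "P T x" "P T' y"] T T' x y by (simp add: P_dom)
  qed
  have "op x = op (P S x + P (- S) x)" using x S by (simp add: P_Compl dom_H)
  also have "\<dots> = op (P S x) + op (P (- S) x)" using x S S' by (simp add: op_add P_dom)
  finally have "P S (op x) = P S (op (P S x)) + P S (op (P (- S) x))"
    using x S S' by (simp add: P_add op_H P_dom)
  also have "P S (op (P (- S) x)) = 0" by (rule cross) (use S S' in auto)
  also have "P S (op (P S x)) = op (P S x) - P (- S) (op (P S x))"
    using x S by (simp add: P_Compl op_H P_dom)
  also have "P (- S) (op (P S x)) = 0" by (rule cross) (use S S' in auto)
  finally show ?thesis by simp
qed

section \<open>Form and norm bounds from the location of the spectrum\<close>

lemma inner_op_symmetric: "x \<in> dom A \<Longrightarrow> y \<in> dom A \<Longrightarrow> inner (op x) y = inner x (op y)"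
  using op_symmetric[of x y] by (metis Re_cinner)

lemma form_ge:
  assumes x: "x \<in> dom A" and S: "S \<in> sets borel" "P S x = x" and a: "\<And>t. t \<in> S \<Longrightarrow> a \<le> t"
  shows "a * (norm x)\<^sup>2 \<le> inner x (op x)"
proof -
  interpret finite_measure "\<mu> x" using x dom_H by (blast intro: finite_measure_\<mu>)
  have "(\<integral>t. a \<partial>\<mu> x) \<le> (\<integral>t. t \<partial>\<mu> x)"
  proof (rule integral_mono_AE[OF _ integrable_\<mu>[OF x]])
    show "AE t in \<mu> x. a \<le> t" using AE_\<mu>[OF dom_H[OF x] S] a by auto
  qed simp
  also have "\<dots> = inner x (op x)"
    using quadratic_form[OF x] Re_cinner[of x "op x"] by simp
  finally show ?thesis using measure_\<mu>[OF dom_H[OF x], of UNIV] P_UNIV[OF dom_H[OF x]]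
    by (simp add: mult.commute)
qed

lemma form_le:
  assumes x: "x \<in> dom A" and S: "S \<in> sets borel" "P S x = x" and a: "\<And>t. t \<in> S \<Longrightarrow> t \<le> a"
  shows "inner x (op x) \<le> a * (norm x)\<^sup>2"
proof -
  interpret finite_measure "\<mu> x" using x dom_H by (blast intro: finite_measure_\<mu>)
  have "(\<integral>t. t \<partial>\<mu> x) \<le> (\<integral>t. a \<partial>\<mu> x)"
  proof (rule integral_mono_AE[OF integrable_\<mu>[OF x]])
    show "AE t in \<mu> x. t \<le> a" using AE_\<mu>[OF dom_H[OF x] S] a by auto
  qed simp
  moreover have "(\<integral>t. t \<partial>\<mu> x) = inner x (op x)"
    using quadratic_form[OF x] Re_cinner[of x "op x"] by simp
  ultimately show ?thesis using measure_\<mu>[OF dom_H[OF x], of UNIV] P_UNIV[OF dom_H[OF x]]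
    by (simp add: mult.commute)
qed

lemma bounded_spectrum_imp_dom:
  assumes x: "x \<in> H" and S: "S \<in> sets borel" "P S x = x" and b: "\<And>t. t \<in> S \<Longrightarrow> \<bar>t\<bar> \<le> K"
  shows "x \<in> dom A"
proof -
  have "(\<integral>\<^sup>+t. ennreal (t\<^sup>2) \<partial>\<mu> x) \<le> (\<integral>\<^sup>+t. ennreal (K\<^sup>2) \<partial>\<mu> x)"
  proof (rule nn_integral_mono_AE)
    have "ennreal (t\<^sup>2) \<le> ennreal (K\<^sup>2)" if "t \<in> S" for t
      using power_mono[OF b[OF that], of 2] by (simp add: ennreal_leI)
    then show "AE t in \<mu> x. ennreal (t\<^sup>2) \<le> ennreal (K\<^sup>2)" using AE_\<mu>[OF x S] by auto
  qed
  also have "\<dots> < \<infinity>"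
    using emeasure_\<mu>[OF x, of UNIV] by (simp add: ennreal_mult_less_top)
  finally show ?thesis using x by (simp add: dom_iff)
qed

text \<open>A symmetric operator is bounded by its quadratic form: \<open>form_ge\<close> and
  \<open>form_le\<close> bound the form of \<open>B = A - m\<close> by \<open>d\<close> on the range
  of \<open>P S\<close>, and polarizing with \<open>y\<close> parallel to \<open>B x\<close>
  recovers \<open>norm (B x)\<close>. \<open>op_P\<close> keeps \<open>y\<close> in that
  range.\<close>

lemma norm_op_le:
  assumes x: "x \<in> H" and S: "S \<in> sets borel" "P S x = x"
    and b: "\<And>t. t \<in> S \<Longrightarrow> \<bar>t - m\<bar> \<le> d" and "0 \<le> d"
  shows "norm (op x - m *\<^sub>R x) \<le> d * norm x"
proof (cases "op x - m *\<^sub>R x = 0")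
  case True
  then show ?thesis using \<open>0 \<le> d\<close> by simp
next
  case False
  have dom: "w \<in> dom A" if "w \<in> H" "P S w = w" for w
    using that(1) S(1) that(2)
  proof (rule bounded_spectrum_imp_dom)
    show "\<bar>t\<bar> \<le> \<bar>m\<bar> + d" if "t \<in> S" for t using b[OF that] by linarith
  qed
  define B where "B w = op w - m *\<^sub>R w" for w
  have form: "\<bar>inner w (B w)\<bar> \<le> d * (norm w)\<^sup>2" if w: "w \<in> H" "P S w = w" for w
  proof -
    have "(m - d) * (norm w)\<^sup>2 \<le> inner w (op w)"
      by (rule form_ge[OF dom[OF w] S(1) w(2)]) (use b in force)
    moreover have "inner w (op w) \<le> (m + d) * (norm w)\<^sup>2"
      by (rule form_le[OF dom[OF w] S(1) w(2)]) (use b in force)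
    ultimately show ?thesis
      by (simp add: B_def inner_diff_right power2_norm_eq_inner abs_le_iff algebra_simps)
  qed
  have xd: "x \<in> dom A" by (rule dom[OF x S(2)])
  have mx: "m *\<^sub>R x \<in> H" using H_scaleC[OF x, of "of_real m"] by (simp add: scaleC_of_real)
  have Bx: "B x \<in> H" unfolding B_def using mx xd by (intro H_diff op_H)
  have "P S (m *\<^sub>R x) = m *\<^sub>R x" using P_scaleC[OF S(1) x, of "of_real m"] S by (simp add: scaleC_of_real)
  then have PBx: "P S (B x) = B x"
    unfolding B_def using op_P[OF xd S(1)] S mx xd by (simp add: P_diff op_H)
  have nz: "norm (B x) > 0" using False by (simp add: B_def)
  \<comment> \<open>This scaling gives \<open>norm y = norm x\<close>, so the parallelogram law
    yields exactly \<open>4 * (norm x)\<^sup>2\<close> and the factor 4 of the polarization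
    cancels.\<close>
  define c where "c = norm x / norm (B x)"
  define y where "y = c *\<^sub>R B x"
  have yH: "y \<in> H" using H_scaleC[OF Bx, of "of_real c"] by (simp add: y_def scaleC_of_real)
  have Py: "P S y = y"
    using P_scaleC[OF S(1) Bx, of "of_real c"] PBx by (simp add: y_def scaleC_of_real)
  have yd: "y \<in> dom A" by (rule dom[OF yH Py])
  have ny: "norm y = norm x" using nz by (simp add: y_def c_def)
  have plus: "\<bar>inner (x + y) (B (x + y))\<bar> \<le> d * (norm (x + y))\<^sup>2"
    by (rule form) (use x yH Py S in \<open>auto simp: H_add P_add\<close>)
  have minus: "\<bar>inner (x - y) (B (x - y))\<bar> \<le> d * (norm (x - y))\<^sup>2"
    by (rule form) (use x yH Py S in \<open>auto simp: H_diff P_diff\<close>)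
  have Bsym: "inner x (B y) = inner y (B x)"
    using inner_op_symmetric[OF xd yd] inner_commute[of "op x" y] inner_commute[of x y]
    by (simp add: B_def inner_diff_right)
  have "inner (x + y) (B (x + y)) - inner (x - y) (B (x - y)) = 4 * inner y (B x)"
  proof -
    have "B (x + y) = B x + B y" "B (x - y) = B x - B y"
      using xd yd by (simp_all add: B_def op_add op_diff algebra_simps)
    then show ?thesis using Bsym by (simp add: inner_simps)
  qed
  moreover have "(norm (x + y))\<^sup>2 + (norm (x - y))\<^sup>2 = 4 * (norm x)\<^sup>2"
  proof -
    have "(norm (x + y))\<^sup>2 + (norm (x - y))\<^sup>2 = 2 * (norm x)\<^sup>2 + 2 * (norm y)\<^sup>2"
      unfolding power2_norm_eq_inner by (simp add: inner_simps)
    then show ?thesis using ny by simp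
  qed
  then have "d * (norm (x + y))\<^sup>2 + d * (norm (x - y))\<^sup>2 = d * (4 * (norm x)\<^sup>2)"
    by (metis distrib_left)
  ultimately have "inner y (B x) \<le> d * (norm x)\<^sup>2" using plus minus by linarith
  moreover have "inner y (B x) = norm x * norm (B x)"
    using nz by (simp add: y_def c_def power2_norm_eq_inner[symmetric] power2_eq_square)
  ultimately have "norm x * norm (B x) \<le> norm x * (d * norm x)"
    by (simp add: power2_eq_square mult_ac)
  moreover have "norm x > 0" using False op_zero by auto
  ultimately show ?thesis by (simp add: B_def)
qed

text \<open>The form of \<open>A - m\<close> has a definite sign only on each side of
  \<open>m\<close>. Splitting at \<open>m\<close>, Cauchy-Schwarz gives the bound on either part,
  and Pythagoras joins the two.\<close>

lemma norm_op_ge: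
  assumes x: "x \<in> dom A" and S: "S \<in> sets borel" "P S x = x"
    and b: "\<And>t. t \<in> S \<Longrightarrow> d \<le> \<bar>t - m\<bar>" and "0 \<le> d"
  shows "d * norm x \<le> norm (op x - m *\<^sub>R x)"
proof -
  define B where "B w = op w - m *\<^sub>R w" for w
  have xH: "x \<in> H" using x by (rule dom_H)
  have mx: "m *\<^sub>R x \<in> H" using H_scaleC[OF xH, of "of_real m"] by (simp add: scaleC_of_real)
  have Bx: "B x \<in> H" unfolding B_def using mx x by (intro H_diff op_H)
  have PB: "B (P T x) = P T (B x)" if T: "T \<in> sets borel" for T
    using op_P[OF x T] P_scaleC[OF T xH, of "of_real m"] T x mx
    by (simp add: B_def P_diff op_H scaleC_of_real)
  have part: "d * norm (P T x) \<le> norm (P T (B x))"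
    if T: "T = {m..} \<or> T = - {m..}" for T
  proof -
    have Tb: "T \<in> sets borel" using T by auto
    let ?y = "P T x"
    have ST: "S \<inter> T \<in> sets borel" using S Tb by auto
    have "P T x = P (S \<inter> T) x" using P_Int[OF Tb S(1) xH] S by (simp add: Int_commute)
    then have y: "P (S \<inter> T) ?y = ?y" using P_idem[OF ST xH] by simp
    have yd: "?y \<in> dom A" using x Tb by (rule P_dom)
    have "d * (norm ?y)\<^sup>2 \<le> \<bar>inner ?y (B ?y)\<bar>"
      using T
    proof
      assume "T = {m..}"
      then have "m + d \<le> t" if "t \<in> S \<inter> T" for t using that b[of t] by auto
      from form_ge[OF yd ST y this] show ?thesis
        by (simp add: B_def inner_diff_right power2_norm_eq_inner algebra_simps)
    next
      assume "T = - {m..}"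
      then have "t \<le> m - d" if "t \<in> S \<inter> T" for t using that b[of t] by auto
      from form_le[OF yd ST y this] show ?thesis
        by (simp add: B_def inner_diff_right power2_norm_eq_inner algebra_simps)
    qed
    also have "\<dots> \<le> norm ?y * norm (B ?y)" by (rule Cauchy_Schwarz_ineq2)
    finally have "norm ?y * (d * norm ?y) \<le> norm ?y * norm (B ?y)"
      by (simp add: power2_eq_square mult_ac)
    then show ?thesis using PB[OF Tb] by (cases "?y = 0") auto
  qed
  have T: "{m..} \<in> sets borel" by simp
  have "(d * norm x)\<^sup>2 = (d * norm (P {m..} x))\<^sup>2 + (d * norm (P (- {m..}) x))\<^sup>2"
    unfolding power_mult_distrib norm_P_Pythagoras[OF T xH] by (simp add: algebra_simps)
  also have "\<dots> \<le> (norm (P {m..} (B x)))\<^sup>2 + (norm (P (- {m..}) (B x)))\<^sup>2"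
    by (intro add_mono power_mono part) (use \<open>0 \<le> d\<close> in auto)
  also have "\<dots> = (norm (B x))\<^sup>2" by (rule norm_P_Pythagoras[OF T Bx, symmetric])
  finally show ?thesis unfolding B_def by (rule power2_le_imp_le) simp
qed

section \<open>Norms of complex shifts and Moebius comparison\<close>

lemma norm_shifted_op:
  assumes y: "y \<in> dom A"
  shows "(norm (op y - Complex (m + \<alpha>) b *\<^sub>C y))\<^sup>2 =
    (norm (op y - m *\<^sub>R y))\<^sup>2 - 2 * \<alpha> * inner y (op y - m *\<^sub>R y) + (\<alpha>\<^sup>2 + b\<^sup>2) * (norm y)\<^sup>2"
proof -
  define u where "u = op y - m *\<^sub>R y - \<alpha> *\<^sub>R y"
  have "Complex (m + \<alpha>) b *\<^sub>C y = m *\<^sub>R y + \<alpha> *\<^sub>R y + (\<i> * of_real b) *\<^sub>C y"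
    unfolding Complex_eq by (simp only: scaleC_add_left scaleC_of_real of_real_add scaleR_add_left)
  then have *: "op y - Complex (m + \<alpha>) b *\<^sub>C y = u - (\<i> * of_real b) *\<^sub>C y"
    by (simp add: u_def algebra_simps)
  \<comment> \<open>The form of \<open>A\<close> being real removes the cross term with the
    imaginary part of the shift.\<close>
  have "Im (cinner u y) = 0"
  proof -
    have "cinner u y = cinner (op y) y - of_real m * cinner y y - of_real \<alpha> * cinner y y"
      unfolding u_def scaleC_of_real[symmetric] by (simp add: cinner_diff_left cinner_scaleC_left)
    moreover have "cinner (op y) y = of_real (\<integral>t. t \<partial>\<mu> y)"
      using op_symmetric[OF y y] quadratic_form[OF y] by simp
    ultimately show ?thesis by (simp add: cinner_self)
  qed
  then have "(norm (op y - Complex (m + \<alpha>) b *\<^sub>C y))\<^sup>2 = (norm u)\<^sup>2 + b\<^sup>2 * (norm y)\<^sup>2"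
    unfolding * norm_diff_square
    by (simp add: cinner_scaleC_right norm_scaleC norm_mult power_mult_distrib)
  also have "(norm u)\<^sup>2 = (norm (op y - m *\<^sub>R y))\<^sup>2 - 2 * \<alpha> * inner y (op y - m *\<^sub>R y) + \<alpha>\<^sup>2 * (norm y)\<^sup>2"
    unfolding u_def norm_diff_square[of "op y - m *\<^sub>R y"]
    by (simp add: Re_cinner power_mult_distrib inner_commute)
  finally show ?thesis by (simp add: algebra_simps)
qed

lemma norm_Im_le:
  assumes y: "y \<in> dom A"
  shows "\<bar>Im w\<bar> * norm y \<le> norm (op y - w *\<^sub>C y)"
proof (rule power2_le_imp_le)
  show "(\<bar>Im w\<bar> * norm y)\<^sup>2 \<le> (norm (op y - w *\<^sub>C y))\<^sup>2"
    using norm_shifted_op[OF y, of "Re w" 0 "Im w"] by (simp add: power_mult_distrib)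
qed simp

text \<open>The number \<open>\<beta>\<close> is chosen so that the circle of Apollonius
  \<open>\<bar>t - m - q \<alpha> - \<i> \<beta>\<bar> = sqrt q \<bar>t - m - \<alpha> - \<i> b\<bar>\<close> meets the real axis in \<open>m - d\<close> and \<open>m + d\<close>.\<close>

lemma norm_mobius:
  assumes y: "y \<in> dom A" and \<beta>: "\<beta>\<^sup>2 = q * (1 - q) * \<alpha>\<^sup>2 + q * b\<^sup>2 - (1 - q) * d\<^sup>2"
  shows "(norm (op y - Complex (m + q * \<alpha>) \<beta> *\<^sub>C y))\<^sup>2 =
    q * (norm (op y - Complex (m + \<alpha>) b *\<^sub>C y))\<^sup>2 +
    (1 - q) * ((norm (op y - m *\<^sub>R y))\<^sup>2 - d\<^sup>2 * (norm y)\<^sup>2)"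
  unfolding norm_shifted_op[OF y] \<beta> by (simp add: power_mult_distrib algebra_simps power2_eq_square)

lemma norm_shift_le:
  "norm (op y - Complex (m + \<alpha>) b *\<^sub>C y) \<le> norm (op y - m *\<^sub>R y) + cmod (Complex \<alpha> b) * norm y"
proof -
  have "Complex (m + \<alpha>) b = of_real m + Complex \<alpha> b" by (simp add: complex_eq_iff)
  then have "op y - Complex (m + \<alpha>) b *\<^sub>C y = (op y - m *\<^sub>R y) - Complex \<alpha> b *\<^sub>C y"
    by (simp add: scaleC_add_left scaleC_of_real diff_diff_eq)
  then show ?thesis using norm_triangle_ineq4[of "op y - m *\<^sub>R y" "Complex \<alpha> b *\<^sub>C y"]
    by (simp only: norm_scaleC)
qed

text \<open>By \<open>norm_mobius\<close> the gain over the factor \<open>q\<close> is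
  \<open>(1 - q) * (X\<^sup>2 - d\<^sup>2 * (norm y)\<^sup>2)\<close> with
  \<open>X = norm (op y - m *\<^sub>R y)\<close>. Since \<open>d' * norm y \<le> X\<close>, it is at
  least \<open>k * X\<^sup>2\<close>, while the norm of the shift by
  \<open>Complex (m + \<alpha>) b\<close> is at most \<open>M * X\<close>; hence the choice
  \<open>k / M\<^sup>2\<close>.\<close>

lemma mobius_expands_outside:
  assumes \<beta>: "\<beta>\<^sup>2 = q * (1 - q) * \<alpha>\<^sup>2 + q * b\<^sup>2 - (1 - q) * d\<^sup>2"
    and q: "q < 1" and d: "0 \<le> d" "d < d'"
  obtains \<delta> where "\<delta> > 0" "\<And>S y. \<lbrakk>y \<in> dom A; S \<in> sets borel; P S y = y; S \<subseteq> {t. d' \<le> \<bar>t - m\<bar>}\<rbrakk> \<Longrightarrow>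
    (q + \<delta>) * (norm (op y - Complex (m + \<alpha>) b *\<^sub>C y))\<^sup>2
      \<le> (norm (op y - Complex (m + q * \<alpha>) \<beta> *\<^sub>C y))\<^sup>2"
proof -
  define c where "c = cmod (Complex \<alpha> b)"
  define M where "M = 1 + c / d'"
  define k where "k = (1 - q) * (1 - d\<^sup>2 / d'\<^sup>2)"
  have "d' > 0" using d by simp
  have "c \<ge> 0" by (simp add: c_def)
  then have "M > 0" using \<open>d' > 0\<close> by (simp add: M_def add_pos_nonneg)
  have "d\<^sup>2 < d'\<^sup>2" using d by (intro power_strict_mono) auto
  then have "k > 0" using q \<open>d' > 0\<close> by (simp add: k_def)
  show thesis
  proof (rule that[of "k / M\<^sup>2"])
    show "k / M\<^sup>2 > 0" using \<open>k > 0\<close> \<open>M > 0\<close> by simp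
    fix S y assume y: "y \<in> dom A" and S: "S \<in> sets borel" "P S y = y" "S \<subseteq> {t. d' \<le> \<bar>t - m\<bar>}"
    define X where "X = norm (op y - m *\<^sub>R y)"
    define N where "N = norm (op y - Complex (m + \<alpha>) b *\<^sub>C y)"
    have low: "d' * norm y \<le> X"
      unfolding X_def by (rule norm_op_ge[OF y S(1,2)]) (use S(3) \<open>d' > 0\<close> in auto)
    then have y_le: "norm y \<le> X / d'" using \<open>d' > 0\<close> by (simp add: field_simps)
    have "N \<le> X + c * norm y" unfolding N_def X_def c_def by (rule norm_shift_le)
    also have "\<dots> \<le> X + c * (X / d')" using y_le \<open>c \<ge> 0\<close> by (intro add_left_mono mult_left_mono)
    also have "\<dots> = M * X" by (simp add: M_def algebra_simps)
    finally have "N\<^sup>2 \<le> (M * X)\<^sup>2" by (rule power_mono) (simp add: N_def)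
    then have "k / M\<^sup>2 * N\<^sup>2 \<le> k / M\<^sup>2 * (M * X)\<^sup>2"
      using \<open>k > 0\<close> by (intro mult_left_mono) auto
    also have "\<dots> = k * X\<^sup>2" using \<open>M > 0\<close> by (simp add: power_mult_distrib)
    also have "\<dots> = (1 - q) * (X\<^sup>2 - d\<^sup>2 * (X / d')\<^sup>2)"
      by (simp add: k_def power_divide algebra_simps)
    also have "\<dots> \<le> (1 - q) * (X\<^sup>2 - d\<^sup>2 * (norm y)\<^sup>2)"
      using q y_le by (intro mult_left_mono diff_left_mono power_mono) auto
    finally show "(q + k / M\<^sup>2) * (norm (op y - Complex (m + \<alpha>) b *\<^sub>C y))\<^sup>2
      \<le> (norm (op y - Complex (m + q * \<alpha>) \<beta> *\<^sub>C y))\<^sup>2"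
      unfolding norm_mobius[OF y \<beta>] N_def X_def by (simp add: distrib_right)
  qed
qed

text \<open>Now \<open>q > 1\<close>, so the gain is
  \<open>(q - 1) * (d\<^sup>2 * (norm y)\<^sup>2 - X\<^sup>2)\<close>. As \<open>X\<close> may be
  zero here, both the gain and the shifted norm are compared with \<open>norm y\<close>
  instead.\<close>

lemma mobius_expands_inside:
  assumes \<beta>: "\<beta>\<^sup>2 = q * (1 - q) * \<alpha>\<^sup>2 + q * b\<^sup>2 - (1 - q) * d\<^sup>2"
    and q: "1 < q" and d: "0 \<le> d'" "d' < d"
  obtains \<delta> where "\<delta> > 0" "\<And>S y. \<lbrakk>y \<in> dom A; S \<in> sets borel; P S y = y; S \<subseteq> {t. \<bar>t - m\<bar> \<le> d'}\<rbrakk> \<Longrightarrow>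
    (q + \<delta>) * (norm (op y - Complex (m + \<alpha>) b *\<^sub>C y))\<^sup>2
      \<le> (norm (op y - Complex (m + q * \<alpha>) \<beta> *\<^sub>C y))\<^sup>2"
proof -
  define c where "c = cmod (Complex \<alpha> b)"
  \<comment> \<open>The summand 1 only ensures \<open>M > 0\<close>.\<close>
  define M where "M = d' + c + 1"
  define k where "k = (q - 1) * (d\<^sup>2 - d'\<^sup>2)"
  have "c \<ge> 0" by (simp add: c_def)
  then have "M > 0" using d by (simp add: M_def)
  have "d'\<^sup>2 < d\<^sup>2" using d by (intro power_strict_mono) auto
  then have "k > 0" using q by (simp add: k_def)
  show thesis
  proof (rule that[of "k / M\<^sup>2"])
    show "k / M\<^sup>2 > 0" using \<open>k > 0\<close> \<open>M > 0\<close> by simp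
    fix S y assume y: "y \<in> dom A" and S: "S \<in> sets borel" "P S y = y" "S \<subseteq> {t. \<bar>t - m\<bar> \<le> d'}"
    define X where "X = norm (op y - m *\<^sub>R y)"
    define N where "N = norm (op y - Complex (m + \<alpha>) b *\<^sub>C y)"
    have X: "X \<le> d' * norm y"
      unfolding X_def by (rule norm_op_le[OF dom_H[OF y] S(1,2)]) (use S(3) d in auto)
    have "N \<le> X + c * norm y" unfolding N_def X_def c_def by (rule norm_shift_le)
    also have "\<dots> \<le> M * norm y" using X by (simp add: M_def algebra_simps add_increasing)
    finally have "N\<^sup>2 \<le> (M * norm y)\<^sup>2" by (rule power_mono) (simp add: N_def)
    then have "k / M\<^sup>2 * N\<^sup>2 \<le> k / M\<^sup>2 * (M * norm y)\<^sup>2"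
      using \<open>k > 0\<close> by (intro mult_left_mono) auto
    also have "\<dots> = k * (norm y)\<^sup>2" using \<open>M > 0\<close> by (simp add: power_mult_distrib)
    also have "\<dots> = (q - 1) * (d\<^sup>2 * (norm y)\<^sup>2 - (d' * norm y)\<^sup>2)"
      by (simp add: k_def power_mult_distrib algebra_simps)
    also have "\<dots> \<le> (q - 1) * (d\<^sup>2 * (norm y)\<^sup>2 - X\<^sup>2)"
      using q X by (intro mult_left_mono diff_left_mono power_mono) (auto simp: X_def)
    also have "\<dots> = (1 - q) * (X\<^sup>2 - d\<^sup>2 * (norm y)\<^sup>2)" by (simp add: algebra_simps)
    finally show "(q + k / M\<^sup>2) * (norm (op y - Complex (m + \<alpha>) b *\<^sub>C y))\<^sup>2
      \<le> (norm (op y - Complex (m + q * \<alpha>) \<beta> *\<^sub>C y))\<^sup>2"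
      unfolding norm_mobius[OF y \<beta>] N_def X_def by (simp add: distrib_right)
  qed
qed

section \<open>The resolvent at a fixed point of the resolvent set\<close>

context
  fixes z :: complex
  assumes z: "z \<in> resolvent_set H A"
begin

lemma bij_shift: "bij_betw (\<lambda>x. op x - z *\<^sub>C x) (dom A) H"
  using z by (simp add: resolvent_set_def)

lemma resolvent_dom: "x \<in> H \<Longrightarrow> resolvent A z x \<in> dom A"
  unfolding resolvent_def using bij_betwE[OF bij_betw_inv_into[OF bij_shift]] by blast

lemma resolvent_H: "x \<in> H \<Longrightarrow> resolvent A z x \<in> H"
  by (rule dom_H[OF resolvent_dom])

lemma op_resolvent: "x \<in> H \<Longrightarrow> op (resolvent A z x) - z *\<^sub>C resolvent A z x = x"
  unfolding resolvent_def using bij_betw_inv_into_right[OF bij_shift] by blast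

lemma resolvent_op: "y \<in> dom A \<Longrightarrow> resolvent A z (op y - z *\<^sub>C y) = y"
  unfolding resolvent_def using bij_betw_inv_into_left[OF bij_shift] by blast

lemma resolvent_eqI: "y \<in> dom A \<Longrightarrow> op y - z *\<^sub>C y = x \<Longrightarrow> resolvent A z x = y"
  using resolvent_op by blast

lemma resolvent_diff: "x \<in> H \<Longrightarrow> y \<in> H \<Longrightarrow> resolvent A z (x - y) = resolvent A z x - resolvent A z y"
  using op_resolvent[of x] op_resolvent[of y]
  by (intro resolvent_eqI)
     (auto simp: dom_diff resolvent_dom op_diff complex_vec.scale_right_diff_distrib algebra_simps)

lemma norm_resolvent_le: "x \<in> H \<Longrightarrow> \<bar>Im z\<bar> * norm (resolvent A z x) \<le> norm x"
  using norm_Im_le[OF resolvent_dom, of x z] by (simp add: op_resolvent)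

text \<open>With \<open>y\<close> the resolvent of \<open>x\<close>, pair
  \<open>x = op y - z *\<^sub>C y\<close> with \<open>y\<close> and use that the form of
  \<open>A\<close> is real. The norm of the resolvent is thereby read off from a single inner
  product.\<close>

lemma norm_resolvent_square:
  assumes "x \<in> H"
  shows "Im z * (norm (resolvent A z x))\<^sup>2 = Im (cinner x (resolvent A z x))"
proof -
  define y where "y = resolvent A z x"
  have y: "y \<in> dom A" using assms by (simp add: y_def resolvent_dom)
  have "cinner x y = cinner (op y - z *\<^sub>C y) y" using assms by (simp add: y_def op_resolvent)
  also have "\<dots> = of_real (\<integral>t. t \<partial>\<mu> y) - cnj z * of_real ((norm y)\<^sup>2)"
    using op_symmetric[OF y y] quadratic_form[OF y]
    by (simp add: cinner_diff_left cinner_scaleC_left cinner_self)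
  finally have "Im (cinner x y) = Im z * (norm y)\<^sup>2" by simp
  then show ?thesis unfolding y_def by simp
qed

text \<open>The equation for \<open>y\<close> is the fixed point equation \<open>f y = y\<close>,
  and \<open>f\<close> contracts with factor \<open>cmod (w - z) / \<bar>Im z\<bar>\<close>. The
  solution inherits \<open>P S y = y\<close> because its \<open>- S\<close> part lies in the kernel
  of \<open>A - w\<close>, which is trivial for nonreal \<open>w\<close>.\<close>

lemma near_resolvent_set_surj:
  assumes w: "cmod (w - z) < \<bar>Im z\<bar>" and x: "x \<in> H" and S: "S \<in> sets borel" "P S x = x"
  shows "\<exists>y\<in>dom A. P S y = y \<and> op y - w *\<^sub>C y = x"
proof -
  have "Im z \<noteq> 0" using w norm_ge_zero[of "w - z"] by auto
  define f where "f y = resolvent A z (x + (w - z) *\<^sub>C y)" for y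
  have "\<exists>!y\<in>H. f y = y"
  proof (rule Banach_fix[where c = "cmod (w - z) / \<bar>Im z\<bar>"])
    show "complete H" using hilbert by (simp add: hilbert_subspace_def complete_eq_closed)
    show "f ` H \<subseteq> H" using x by (auto simp: f_def intro!: resolvent_H H_add H_scaleC)
    show "dist (f u) (f v) \<le> cmod (w - z) / \<bar>Im z\<bar> * dist u v" if uv: "u \<in> H" "v \<in> H" for u v
    proof -
      have "f u - f v = resolvent A z ((w - z) *\<^sub>C (u - v))"
        unfolding f_def using x uv
        by (simp add: resolvent_diff[symmetric] H_add H_scaleC complex_vec.scale_right_diff_distrib)
      moreover have "\<bar>Im z\<bar> * norm (resolvent A z ((w - z) *\<^sub>C (u - v))) \<le> norm ((w - z) *\<^sub>C (u - v))"
        using uv by (intro norm_resolvent_le H_scaleC H_diff) auto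
      ultimately have "norm (f u - f v) \<le> cmod (w - z) * norm (u - v) / \<bar>Im z\<bar>"
        using \<open>Im z \<noteq> 0\<close> by (simp add: norm_scaleC pos_le_divide_eq mult.commute)
      then show ?thesis by (simp add: dist_norm)
    qed
  qed (use w H_zero \<open>Im z \<noteq> 0\<close> in auto)
  then obtain y where y: "y \<in> H" "f y = y" by blast
  have xy: "x + (w - z) *\<^sub>C y \<in> H" using x y by (intro H_add H_scaleC)
  have yd: "y \<in> dom A" using resolvent_dom[OF xy] y by (simp add: f_def)
  have "op y - z *\<^sub>C y = x + (w - z) *\<^sub>C y" using op_resolvent[OF xy] y by (simp add: f_def)
  then have eq: "op y - w *\<^sub>C y = x" by (simp add: complex_vec.scale_left_diff_distrib algebra_simps)
  \<comment> \<open>A real \<open>w\<close> would be at distance at least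
    \<open>\<bar>Im z\<bar>\<close> from \<open>z\<close>.\<close>
  have "Im w \<noteq> 0" using w abs_Im_le_cmod[of "w - z"] by auto
  have S': "- S \<in> sets borel" using S by (auto intro: borel_comp)
  have "op (P (- S) y) - w *\<^sub>C P (- S) y = P (- S) x"
    using yd y S' eq[symmetric] by (simp add: op_P P_diff P_scaleC op_H H_scaleC)
  also have "\<dots> = 0" using x S by (simp add: P_Compl)
  finally have "\<bar>Im w\<bar> * norm (P (- S) y) \<le> 0" using norm_Im_le[OF P_dom[OF yd S'], of w] by simp
  then have "P (- S) y = 0" using \<open>Im w \<noteq> 0\<close> by (simp add: mult_le_0_iff)
  then show ?thesis using yd eq P_Compl_zero_iff[OF S(1) y(1)] by blast
qed

end

end

text \<open>At \<open>q = 1\<close> the right-hand side is \<open>b\<^sup>2 > 0\<close>, so a root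
  near \<open>b\<close> persists by continuity. The distance bound puts the shift where
  \<open>near_resolvent_set_surj\<close> applies; \<open>transfer_outside\<close> takes
  \<open>q\<close> below 1 and \<open>transfer_inside\<close> takes it above.\<close>

lemma mobius_parameter:
  fixes b :: real
  assumes "b \<noteq> 0"
  shows "\<forall>\<^sub>F q in at 1. \<exists>\<beta>. \<beta>\<^sup>2 = q * (1 - q) * \<alpha>\<^sup>2 + q * b\<^sup>2 - (1 - q) * d\<^sup>2 \<and>
    cmod (Complex (m + q * \<alpha>) \<beta> - Complex (m + \<alpha>) b) < \<bar>b\<bar>"
proof -
  define e where "e q = q * (1 - q) * \<alpha>\<^sup>2 + q * b\<^sup>2 - (1 - q) * d\<^sup>2" for q
  \<comment> \<open>This is the square root of \<open>e q\<close> carrying the sign of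
    \<open>b\<close>, so that it tends to \<open>b\<close> and not to
    \<open>\<bar>b\<bar>\<close>.\<close>
  define g where "g q = b * sqrt (e q / b\<^sup>2)" for q
  have e: "(e \<longlongrightarrow> b\<^sup>2) (at 1)" unfolding e_def by (auto intro!: tendsto_eq_intros)
  have g: "(g \<longlongrightarrow> b) (at 1)"
    unfolding g_def using assms by (auto intro!: tendsto_eq_intros e)
  have "((\<lambda>q. cmod (Complex (m + q * \<alpha>) (g q) - Complex (m + \<alpha>) b))
      \<longlongrightarrow> cmod (Complex (m + 1 * \<alpha>) b - Complex (m + \<alpha>) b)) (at 1)"
    by (intro tendsto_intros tendsto_Complex g)
  then have "\<forall>\<^sub>F q in at 1. cmod (Complex (m + q * \<alpha>) (g q) - Complex (m + \<alpha>) b) < \<bar>b\<bar>"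
    by (rule order_tendstoD(2)) (use assms in simp)
  moreover have "\<forall>\<^sub>F q in at 1. e q > 0" by (rule order_tendstoD(1)[OF e]) (use assms in simp)
  ultimately show ?thesis
  proof eventually_elim
    case (elim q)
    have "(g q)\<^sup>2 = e q" using elim assms by (simp add: g_def power_mult_distrib)
    then show ?case using elim unfolding e_def by blast
  qed
qed

section \<open>Dimensions of ranges\<close>

lemma independent_family:
  fixes f :: "'b \<Rightarrow> 'a::complex_inner"
  assumes C: "finite C"
    and zero: "\<And>u. (\<Sum>c\<in>C. u c *\<^sub>C f c) = 0 \<Longrightarrow> \<forall>c\<in>C. u c = 0"
  shows "inj_on f C \<and> complex_vec.independent (f ` C)"
proof
  show inj: "inj_on f C"
  proof (rule inj_onI, rule ccontr)
    fix a b assume ab: "a \<in> C" "b \<in> C" "f a = f b" "a \<noteq> b"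
    define u :: "'b \<Rightarrow> complex" where "u c = (if c = a then 1 else if c = b then -1 else 0)" for c
    have "(\<Sum>c\<in>C. u c *\<^sub>C f c) = (\<Sum>c\<in>{a, b}. u c *\<^sub>C f c)"
      by (rule sum.mono_neutral_right) (use C ab in \<open>auto simp: u_def\<close>)
    also have "\<dots> = 0" using ab by (simp add: u_def)
    finally have "u a = 0" using zero[of u] ab(1) by blast
    then show False by (simp add: u_def)
  qed
  show "complex_vec.independent (f ` C)"
  proof (rule complex_vec.independent_if_scalars_zero)
    fix u x assume "(\<Sum>x\<in>f ` C. u x *\<^sub>C x) = 0" "x \<in> f ` C"
    then show "u x = 0" using zero[of "\<lambda>c. u (f c)"] by (auto simp: sum.reindex[OF inj])
  qed (use C in simp)
qed

text \<open>Finite and infinite dimensions are treated alike through finite independent subsets, to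
  which all later comparisons reduce.\<close>

lemma enat_le_cdim_iff:
  "enat k \<le> cdim S \<longleftrightarrow> (\<exists>C\<subseteq>S. finite C \<and> card C = k \<and> complex_vec.independent C)"
proof
  obtain B where B: "B \<subseteq> S" "complex_vec.independent B" "S \<subseteq> complex_vec.span B"
    "card B = complex_vec.dim S"
    using complex_vec.basis_exists by metis
  have sub: "\<exists>C\<subseteq>S. finite C \<and> card C = k \<and> complex_vec.independent C"
    if "D \<subseteq> B" "finite D" "card D = k" for D
    using that B complex_vec.independent_mono by blast
  show "\<exists>C\<subseteq>S. finite C \<and> card C = k \<and> complex_vec.independent C" if k: "enat k \<le> cdim S"
  proof (cases "finite B")
    case True
    then have "k \<le> card B" using k B by (auto simp: cdim_def split: if_splits)
    then obtain D where "D \<subseteq> B" "card D = k" by (metis obtain_subset_with_card_n)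
    then show ?thesis using True sub finite_subset by blast
  next
    case False
    then obtain D where "D \<subseteq> B" "finite D" "card D = k" using infinite_arbitrarily_large by blast
    then show ?thesis by (rule sub)
  qed
  assume "\<exists>C\<subseteq>S. finite C \<and> card C = k \<and> complex_vec.independent C"
  then obtain C where C: "C \<subseteq> S" "card C = k" "complex_vec.independent C" by blast
  show "enat k \<le> cdim S"
  proof (cases "\<exists>B. finite B \<and> S \<subseteq> complex_vec.span B")
    case True
    then obtain B0 where B0: "finite B0" "S \<subseteq> complex_vec.span B0" by blast
    then have "finite B" using complex_vec.independent_span_bound[of B0 B] B by auto
    then have "card C \<le> card B" using complex_vec.independent_span_bound[of B C] B C by auto
    then show ?thesis using True C B by (simp add: cdim_def)
  next
    case False
    then have "cdim S = \<infinity>" by (simp only: cdim_def if_False)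
    then show ?thesis by simp
  qed
qed

lemma enat_le_by_lower_bounds:
  assumes "\<And>k. enat k \<le> a \<Longrightarrow> enat k \<le> b"
  shows "a \<le> b"
proof (cases b)
  case (enat m)
  then have "\<not> enat (Suc m) \<le> a" using assms[of "Suc m"] by auto
  then show ?thesis using enat by (simp add: Suc_ile_eq)
qed simp

lemma cdim_mono: "S \<subseteq> T \<Longrightarrow> cdim S \<le> cdim T"
  by (rule enat_le_by_lower_bounds) (auto simp: enat_le_cdim_iff)

lemma cdim_eq_0: "S \<subseteq> {0} \<Longrightarrow> cdim S = 0"
proof -
  assume S: "S \<subseteq> {0}"
  have "cdim S \<le> 0"
  proof (rule enat_le_by_lower_bounds)
    fix k assume "enat k \<le> cdim S"
    then obtain C where C: "C \<subseteq> S" "card C = k" "complex_vec.independent C"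
      by (auto simp: enat_le_cdim_iff)
    then have "C = {}" using S complex_vec.dependent_zero by blast
    then show "enat k \<le> 0" using C by (simp add: zero_enat_def)
  qed
  then show ?thesis by simp
qed

text \<open>Preimages of an independent set are independent, since \<open>L\<close> carries every
  linear relation among them to one among the images.\<close>

lemma cdim_image_le:
  fixes L :: "'a::complex_inner \<Rightarrow> 'b::complex_inner"
  assumes add: "\<And>x y. L (x + y) = L x + L y" and scale: "\<And>a x. L (a *\<^sub>C x) = a *\<^sub>C L x"
  shows "cdim (L ` S) \<le> cdim S"
proof (rule enat_le_by_lower_bounds)
  fix k assume "enat k \<le> cdim (L ` S)"
  then obtain C where C: "C \<subseteq> L ` S" "finite C" "card C = k" "complex_vec.independent C"
    by (auto simp: enat_le_cdim_iff)
  then have "\<forall>c\<in>C. \<exists>x\<in>S. L x = c" by auto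
  then obtain g where g: "\<And>c. c \<in> C \<Longrightarrow> g c \<in> S \<and> L (g c) = c" by metis
  have "L 0 = 0" using add[of 0 0] by simp
  then have L_sum: "L (\<Sum>i\<in>I. h i) = (\<Sum>i\<in>I. L (h i))" for h :: "'b \<Rightarrow> 'a" and I
    by (induction I rule: infinite_finite_induct) (auto simp: add)
  have "inj_on g C \<and> complex_vec.independent (g ` C)"
  proof (rule independent_family[OF C(2)])
    fix u assume "(\<Sum>c\<in>C. u c *\<^sub>C g c) = 0"
    then have "(\<Sum>c\<in>C. L (u c *\<^sub>C g c)) = 0" using \<open>L 0 = 0\<close> by (metis L_sum)
    then have "(\<Sum>c\<in>C. u c *\<^sub>C c) = 0" using g by (simp add: scale)
    then show "\<forall>c\<in>C. u c = 0" using complex_vec.independentD[OF C(4,2) order_refl] by blast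
  qed
  then show "enat k \<le> cdim S"
    unfolding enat_le_cdim_iff using C g by (intro exI[of _ "g ` C"]) (auto simp: card_image)
qed

text \<open>Induction over \<open>C\<close>. A new vector \<open>c\<close> already in the span
  changes nothing; otherwise a vector \<open>v\<close> dual to \<open>c\<close> allows
  \<open>b\<close> and then \<open>w\<close> to be corrected.\<close>

lemma dual_vector:
  fixes b :: "'a::complex_inner"
  assumes "finite C" "b \<notin> complex_vec.span C"
  shows "\<exists>w. cinner w b = 1 \<and> (\<forall>c\<in>C. cinner w c = 0)"
  using assms
proof (induction C arbitrary: b rule: finite_induct)
  case empty
  then have "b \<noteq> 0" by simp
  then have "cinner (complex_of_real (inverse ((norm b)\<^sup>2)) *\<^sub>C b) b = 1"
    by (simp add: cinner_scaleC_left cinner_self)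
  then show ?case by blast
next
  case (insert c C)
  show ?case
  proof (cases "c \<in> complex_vec.span C")
    case True
    then have "b \<notin> complex_vec.span C" using insert.prems by (simp add: complex_vec.span_redundant)
    then obtain w where w: "cinner w b = 1" "\<forall>c\<in>C. cinner w c = 0" using insert.IH by blast
    have "cinner w c = 0"
      using True
    proof (induction rule: complex_vec.span_induct_alt)
      case base
      then show ?case by simp
    next
      case (step a x y)
      then show ?case using w by (simp add: cinner_add_right cinner_scaleC_right)
    qed
    then show ?thesis using w by auto
  next
    case False
    then obtain v where v: "cinner v c = 1" "\<forall>c\<in>C. cinner v c = 0" using insert.IH by blast
    \<comment> \<open>Subtracting this multiple of \<open>c\<close> makes
      \<open>cinner v b' = 0\<close>.\<close>
    define b' where "b' = b - cinner v b *\<^sub>C c"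
    have "b' \<notin> complex_vec.span C"
      using insert.prems unfolding b'_def complex_vec.span_breakdown_eq by blast
    then obtain w where w: "cinner w b' = 1" "\<forall>c\<in>C. cinner w c = 0" using insert.IH by blast
    \<comment> \<open>The correction makes \<open>w'\<close> orthogonal to \<open>c\<close>; the
      pairings with \<open>C\<close> and \<open>b'\<close> are unaffected as \<open>v\<close> is
      orthogonal to both.\<close>
    define w' where "w' = w - cnj (cinner w c) *\<^sub>C v"
    have "cinner w' c = 0" by (simp add: w'_def cinner_diff_left cinner_scaleC_left v)
    moreover have "\<forall>x\<in>C. cinner w' x = 0"
      using v w by (simp add: w'_def cinner_diff_left cinner_scaleC_left)
    moreover have "cinner w' b = 1"
    proof -
      have "cinner v b' = 0" by (simp add: b'_def cinner_diff_right cinner_scaleC_right v)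
      then have "cinner w' b' = 1" using w by (simp add: w'_def cinner_diff_left cinner_scaleC_left)
      then show ?thesis using \<open>cinner w' c = 0\<close>
        by (simp add: b'_def cinner_diff_right cinner_scaleC_right)
    qed
    ultimately show ?thesis by blast
  qed
qed

text \<open>For a system \<open>w\<close> dual to \<open>C\<close>, the matrix of
  \<open>cinner (w c) (f n c')\<close> tends to the identity. In a vanishing combination the
  coefficient of largest modulus would eventually be strictly smaller than itself.\<close>

lemma eventually_independent:
  fixes f :: "nat \<Rightarrow> 'a::complex_inner \<Rightarrow> 'a"
  assumes C: "finite C" "complex_vec.independent C"
    and lim: "\<And>c. c \<in> C \<Longrightarrow> (\<lambda>n. f n c) \<longlonglongrightarrow> c"
  shows "\<forall>\<^sub>F n in sequentially. inj_on (f n) C \<and> complex_vec.independent (f n ` C)"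
proof -
  have "\<exists>w. cinner w c = 1 \<and> (\<forall>c'\<in>C - {c}. cinner w c' = 0)" if "c \<in> C" for c
  proof (rule dual_vector)
    show "c \<notin> complex_vec.span (C - {c})"
      using C that by (auto simp: complex_vec.dependent_def)
  qed (use C in simp)
  then obtain w where w': "\<And>c. c \<in> C \<Longrightarrow> cinner (w c) c = 1 \<and> (\<forall>c'\<in>C - {c}. cinner (w c) c' = 0)"
    by metis
  then have w: "\<And>c. c \<in> C \<Longrightarrow> cinner (w c) c = 1"
      "\<And>c c'. c \<in> C \<Longrightarrow> c' \<in> C \<Longrightarrow> c' \<noteq> c \<Longrightarrow> cinner (w c) c' = 0"
    by auto
  \<comment> \<open>Chosen such that the sum of \<open>card C\<close> errors stays strictly below
    1.\<close>
  define \<epsilon> where "\<epsilon> = 1 / (real (card C) + 1)"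
  have "\<epsilon> > 0" by (simp add: \<epsilon>_def add_nonneg_pos)
  have "\<forall>\<^sub>F n in sequentially. \<forall>c\<in>C. \<forall>c'\<in>C. cmod (cinner (w c) (f n c' - c')) < \<epsilon>"
  proof (intro eventually_ball_finite C ballI)
    fix c c' assume "c' \<in> C"
    have "(\<lambda>n. cmod (cinner (w c) (f n c' - c'))) \<longlonglongrightarrow> cmod (cinner (w c) (c' - c'))"
      by (intro tendsto_norm tendsto_cinner_right tendsto_diff lim \<open>c' \<in> C\<close> tendsto_const)
    then show "\<forall>\<^sub>F n in sequentially. cmod (cinner (w c) (f n c' - c')) < \<epsilon>"
      by (rule order_tendstoD(2)) (use \<open>\<epsilon> > 0\<close> in simp)
  qed
  then show ?thesis
  proof eventually_elim
    case (elim n)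
    show ?case
    proof (rule independent_family[OF C(1)], rule ccontr)
      fix u assume u: "(\<Sum>c\<in>C. u c *\<^sub>C f n c) = 0" and "\<not> (\<forall>c\<in>C. u c = 0)"
      then obtain c0 where c0: "c0 \<in> C" "u c0 \<noteq> 0" by blast
      obtain c where c: "c \<in> C" "\<And>c'. c' \<in> C \<Longrightarrow> cmod (u c') \<le> cmod (u c)"
      proof -
        have fin: "finite ((\<lambda>c. cmod (u c)) ` C)" using C by simp
        then have "Max ((\<lambda>c. cmod (u c)) ` C) \<in> (\<lambda>c. cmod (u c)) ` C" using c0 by (intro Max_in) auto
        then obtain c where "c \<in> C" "Max ((\<lambda>c. cmod (u c)) ` C) = cmod (u c)" by auto
        then show thesis using that[of c] Max_ge[OF fin] by simp
      qed
      have "cmod (u c) > 0" using c(2)[OF c0(1)] c0(2) by auto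
      have "(\<Sum>c'\<in>C. u c' * cinner (w c) (f n c' - c')) =
          cinner (w c) (\<Sum>c'\<in>C. u c' *\<^sub>C f n c') - (\<Sum>c'\<in>C. u c' * cinner (w c) c')"
        by (simp add: cinner_sum_right cinner_scaleC_right cinner_diff_right right_diff_distrib sum_subtractf)
      also have "(\<Sum>c'\<in>C. u c' * cinner (w c) c') = (\<Sum>c'\<in>{c}. u c' * cinner (w c) c')"
        by (rule sum.mono_neutral_right) (use C c w in auto)
      finally have "u c = - (\<Sum>c'\<in>C. u c' * cinner (w c) (f n c' - c'))"
        using u w(1)[OF c(1)] by simp
      then have "cmod (u c) = cmod (\<Sum>c'\<in>C. u c' * cinner (w c) (f n c' - c'))"
        by (metis norm_minus_cancel)
      also have "\<dots> \<le> (\<Sum>c'\<in>C. cmod (u c) * \<epsilon>)"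
      proof (rule sum_norm_le)
        fix c' assume c': "c' \<in> C"
        have "cmod (cinner (w c) (f n c' - c')) \<le> \<epsilon>" using elim c c' by (simp add: less_imp_le)
        then show "cmod (u c' * cinner (w c) (f n c' - c')) \<le> cmod (u c) * \<epsilon>"
          unfolding norm_mult using c c' by (intro mult_mono) auto
      qed
      also have "\<dots> = cmod (u c) * (real (card C) * \<epsilon>)" by simp
      also have "real (card C) * \<epsilon> < 1" by (simp add: \<epsilon>_def)
      then have "cmod (u c) * (real (card C) * \<epsilon>) < cmod (u c)" using \<open>cmod (u c) > 0\<close> by simp
      finally show False by simp
    qed
  qed
qed

text \<open>Finitely many independent vectors in the range of \<open>S\<close> are limits of vectors
  in the ranges of \<open>T n\<close>, and these are eventually independent.\<close>

lemma cdim_range_le_liminf: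
  fixes T :: "nat \<Rightarrow> 'a::complex_hilbert \<Rightarrow> 'a"
  assumes "strong_limit T S"
  shows "cdim (range S) \<le> liminf (\<lambda>n. cdim (range (T n)))"
  unfolding le_Liminf_iff
proof (intro allI impI)
  fix y assume y: "y < cdim (range S)"
  then obtain k where k: "y = enat k" by (cases y) auto
  then have "enat (Suc k) \<le> cdim (range S)" using y by (simp add: Suc_ile_eq)
  then obtain C where C: "C \<subseteq> range S" "finite C" "card C = Suc k" "complex_vec.independent C"
    by (auto simp: enat_le_cdim_iff)
  then have "\<forall>c\<in>C. \<exists>x. S x = c" by auto
  then obtain g where g: "\<And>c. c \<in> C \<Longrightarrow> S (g c) = c" by metis
  have "\<And>c. c \<in> C \<Longrightarrow> (\<lambda>n. T n (g c)) \<longlonglongrightarrow> c"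
    using assms g unfolding strong_limit_def by metis
  then have "\<forall>\<^sub>F n in sequentially. inj_on (\<lambda>c. T n (g c)) C \<and>
      complex_vec.independent ((\<lambda>c. T n (g c)) ` C)"
    by (rule eventually_independent[OF C(2,4)])
  then show "\<forall>\<^sub>F n in sequentially. y < cdim (range (T n))"
  proof eventually_elim
    case (elim n)
    then have "enat (Suc k) \<le> cdim (range (T n))"
      unfolding enat_le_cdim_iff using C by (intro exI[of _ "(\<lambda>c. T n (g c)) ` C"]) (auto simp: card_image)
    then show ?case by (simp add: k Suc_ile_eq)
  qed
qed

section \<open>Convergence of spectral projections\<close>

text \<open>Applying \<open>step\<close> \<open>k\<close> times bounds \<open>f n x\<close> by
  \<open>C * \<theta> ^ k * norm x\<close> plus \<open>k\<close> null sequences. The number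
  \<open>k\<close> is fixed first to make the main term small, and \<open>n\<close> tends to
  infinity afterwards.\<close>

lemma iterated_contraction_tendsto_zero:
  fixes f :: "nat \<Rightarrow> 'a::real_normed_vector \<Rightarrow> real"
  assumes bound: "\<And>n x. f n x \<le> C * norm x" and nonneg: "\<And>n x. 0 \<le> f n x"
    and "0 \<le> C" "0 < \<kappa>" "0 \<le> \<theta>" "\<theta> < 1"
    and step: "\<And>x. x \<in> V \<Longrightarrow> \<exists>y\<in>V. \<kappa> * norm y \<le> \<theta> * norm x \<and>
      (\<exists>e. e \<longlonglongrightarrow> 0 \<and> (\<forall>n. f n x \<le> \<kappa> * f n y + e n))"
    and x: "x \<in> V"
  shows "(\<lambda>n. f n x) \<longlonglongrightarrow> 0"
proof -
  have iterate: "\<forall>\<^sub>F n in sequentially. f n x \<le> C * \<theta> ^ k * norm x + \<epsilon>"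
    if "x \<in> V" "\<epsilon> > 0" for k x \<epsilon>
    using that
  proof (induction k arbitrary: x \<epsilon>)
    case 0
    have "f n x \<le> C * norm x + \<epsilon>" for n using bound[of n x] 0 by linarith
    then show ?case by simp
  next
    case (Suc k)
    obtain y e where y: "y \<in> V" "\<kappa> * norm y \<le> \<theta> * norm x" "e \<longlonglongrightarrow> 0"
        "\<And>n. f n x \<le> \<kappa> * f n y + e n"
      using step[OF \<open>x \<in> V\<close>] by blast
    have "\<forall>\<^sub>F n in sequentially. e n < \<epsilon> / 2"
      by (rule order_tendstoD(2)[OF y(3)]) (use Suc.prems in simp)
    \<comment> \<open>The tolerance for \<open>y\<close> is divided by \<open>2 * \<kappa>\<close>
      because \<open>step\<close> multiplies it by \<open>\<kappa>\<close>; the other half of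
      \<open>\<epsilon>\<close> absorbs \<open>e n\<close>.\<close>
    moreover have "\<forall>\<^sub>F n in sequentially. f n y \<le> C * \<theta> ^ k * norm y + \<epsilon> / (2 * \<kappa>)"
      by (rule Suc.IH) (use y Suc.prems \<open>0 < \<kappa>\<close> in auto)
    ultimately show ?case
    proof eventually_elim
      case (elim n)
      have "f n x \<le> \<kappa> * f n y + \<epsilon> / 2" using y(4)[of n] elim by linarith
      also have "\<kappa> * f n y \<le> \<kappa> * (C * \<theta> ^ k * norm y + \<epsilon> / (2 * \<kappa>))"
        using elim \<open>0 < \<kappa>\<close> by (intro mult_left_mono) auto
      also have "\<dots> = C * \<theta> ^ k * (\<kappa> * norm y) + \<epsilon> / 2" using \<open>0 < \<kappa>\<close> by (simp add: field_simps)
      also have "\<dots> \<le> C * \<theta> ^ k * (\<theta> * norm x) + \<epsilon> / 2"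
        using y(2) \<open>0 \<le> C\<close> \<open>0 \<le> \<theta>\<close> by (intro add_right_mono mult_left_mono) auto
      finally show ?case by (simp add: mult_ac)
    qed
  qed
  show ?thesis
  proof (rule order_tendstoI)
    show "\<forall>\<^sub>F n in sequentially. a < f n x" if "a < 0" for a
      using nonneg[of _ x] that by (intro always_eventually allI) (meson less_le_trans)
    show "\<forall>\<^sub>F n in sequentially. f n x < a" if "0 < a" for a
    proof -
      have "(\<lambda>k. C * \<theta> ^ k * norm x) \<longlonglongrightarrow> C * 0 * norm x"
        using assms by (intro tendsto_intros LIMSEQ_power_zero) auto
      then have "\<forall>\<^sub>F k in sequentially. C * \<theta> ^ k * norm x < a / 2"
        by (rule order_tendstoD(2)) (use that in simp)
      then obtain k where k: "C * \<theta> ^ k * norm x < a / 2" by (auto simp: eventually_sequentially)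
      have "\<forall>\<^sub>F n in sequentially. f n x \<le> C * \<theta> ^ k * norm x + a / 2"
        by (rule iterate[OF x]) (use that in simp)
      then show ?thesis by eventually_elim (use k in linarith)
    qed
  qed
qed

locale resolvent_convergence =
  fixes H\<^sub>n :: "nat \<Rightarrow> 'b::complex_hilbert set"
    and J :: "nat \<Rightarrow> 'a::complex_hilbert \<Rightarrow> 'b"
    and A :: "'a \<rightharpoonup> 'a" and A\<^sub>n :: "nat \<Rightarrow> 'b \<rightharpoonup> 'b"
    and P :: "real set \<Rightarrow> 'a \<Rightarrow> 'a" and P\<^sub>n :: "nat \<Rightarrow> real set \<Rightarrow> 'b \<Rightarrow> 'b"
    and C :: real and z :: complex
  assumes A: "spectral_operator UNIV A P" and A\<^sub>n: "\<And>n. spectral_operator (H\<^sub>n n) (A\<^sub>n n) (P\<^sub>n n)"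
    and J: "\<And>n. bounded_clinear (J n)" and J_range: "\<And>n x. J n x \<in> H\<^sub>n n"
    and C: "C > 0" "\<And>n. onorm (J n) \<le> C"
    and J_adj: "\<And>\<psi>. (\<lambda>n. cadjoint (J n) (J n \<psi>)) \<longlonglongrightarrow> \<psi>"
    and z: "z \<in> resolvent_set UNIV A" "\<And>n. z \<in> resolvent_set (H\<^sub>n n) (A\<^sub>n n)" "Im z \<noteq> 0"
    and resolvent_lim: "\<And>\<psi>. (\<lambda>n. cadjoint (J n) (resolvent (A\<^sub>n n) z (J n \<psi>))) \<longlonglongrightarrow> resolvent A z \<psi>"
begin

section \<open>Asymptotic isometry and intertwining of resolvents\<close>

interpretation a: spectral_operator UNIV A P by (rule A)

interpretation n: spectral_operator "H\<^sub>n n" "A\<^sub>n n" "P\<^sub>n n" for n by (rule A\<^sub>n)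

lemma J_linear: "bounded_linear (J n)"
  using J by (simp add: bounded_clinear_def)

lemma J_add: "J n (x + y) = J n x + J n y"
  using J_linear by (rule linear_simps)

lemma J_diff: "J n (x - y) = J n x - J n y"
  using J_linear by (rule linear_simps)

lemma J_scaleC: "J n (c *\<^sub>C x) = c *\<^sub>C J n x"
  using J by (simp add: bounded_clinear_def)

lemma norm_J_le: "norm (J n x) \<le> C * norm x"
  using onorm[OF J_linear, of n x] C(2)[of n] by (meson mult_right_mono norm_ge_zero order_trans)

text \<open>\<open>(norm (J n x))\<^sup>2\<close> is the inner product of \<open>x\<close> with
  \<open>cadjoint (J n) (J n x)\<close>, which tends to \<open>x\<close>.\<close>

lemma norm_J_tendsto: "(\<lambda>n. (norm (J n x))\<^sup>2) \<longlonglongrightarrow> (norm x)\<^sup>2"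
proof -
  have "(norm (J n x))\<^sup>2 = Re (cinner x (cadjoint (J n) (J n x)))" for n
    by (simp add: cinner_cadjoint[OF J, symmetric] cinner_self)
  moreover have "(\<lambda>n. Re (cinner x (cadjoint (J n) (J n x)))) \<longlonglongrightarrow> Re (cinner x x)"
    by (intro tendsto_Re tendsto_cinner_right J_adj)
  ultimately show ?thesis by (simp add: cinner_self)
qed

text \<open>Weak convergence plus convergence of norms. The norm of \<open>R\<^sub>n J\<^sub>n \<psi>\<close> is controlled through
  the identity \<open>Im z \<parallel>R x\<parallel>\<^sup>2 = Im \<langle>x, R x\<rangle>\<close>, which needs \<open>z\<close> nonreal.\<close>

lemma resolvent_intertwining:
  "(\<lambda>n. J n (resolvent A z \<psi>) - resolvent (A\<^sub>n n) z (J n \<psi>)) \<longlonglongrightarrow> 0"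
proof -
  define u where "u = resolvent A z \<psi>"
  define v where "v n = resolvent (A\<^sub>n n) z (J n \<psi>)" for n
  have v_lim: "(\<lambda>n. cadjoint (J n) (v n)) \<longlonglongrightarrow> u"
    unfolding u_def v_def by (rule resolvent_lim)
  have norm_v: "(norm (v n))\<^sup>2 = Im (cinner \<psi> (cadjoint (J n) (v n))) / Im z" for n
    using n.norm_resolvent_square[OF z(2) J_range] z(3)
    by (simp add: v_def cinner_cadjoint[OF J, symmetric] field_simps)
  have norm_u: "(norm u)\<^sup>2 = Im (cinner \<psi> u) / Im z"
    using a.norm_resolvent_square[OF z(1)] z(3) by (simp add: u_def field_simps)
  have "(\<lambda>n. (norm (v n))\<^sup>2) \<longlonglongrightarrow> (norm u)\<^sup>2"
    unfolding norm_v norm_u using z(3) by (intro tendsto_intros tendsto_Im tendsto_cinner_right v_lim)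
  moreover have "(\<lambda>n. Re (cinner u (cadjoint (J n) (v n)))) \<longlonglongrightarrow> Re (cinner u u)"
    by (intro tendsto_Re tendsto_cinner_right v_lim)
  ultimately have "(\<lambda>n. (norm (J n u))\<^sup>2 - 2 * Re (cinner u (cadjoint (J n) (v n))) + (norm (v n))\<^sup>2)
      \<longlonglongrightarrow> (norm u)\<^sup>2 - 2 * Re (cinner u u) + (norm u)\<^sup>2"
    by (intro tendsto_add tendsto_diff tendsto_mult_left norm_J_tendsto)
  then have "(\<lambda>n. (norm (J n u - v n))\<^sup>2) \<longlonglongrightarrow> 0"
    by (simp add: norm_diff_square[of "J _ u"] cinner_cadjoint[OF J] cinner_self)
  from tendsto_real_sqrt[OF this] have "(\<lambda>n. norm (J n u - v n)) \<longlonglongrightarrow> 0" by simp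
  then show ?thesis unfolding u_def v_def by (rule tendsto_norm_zero_cancel)
qed

text \<open>With \<open>T = (A - w)(A - z)\<^sup>-\<^sup>1\<close> and \<open>T\<^sub>n\<close> likewise, \<open>T\<^sub>n J\<^sub>n - J\<^sub>n T\<close> tends to 0 strongly. As \<open>T\<close>
  expands the range of \<open>P S\<close> more than \<open>T\<^sub>n\<close> expands that of \<open>P\<^sub>n S'\<close>, writing \<open>\<psi> = T\<^sup>k \<phi>\<close> shows
  that \<open>P\<^sub>n S' J\<^sub>n \<psi>\<close> is asymptotically smaller than any power of the ratio.\<close>

lemma spectral_transfer:
  assumes S: "S \<in> sets borel" and S': "S' \<in> sets borel"
    and w: "cmod (w - z) < \<bar>Im z\<bar>" and "0 < q" "0 < \<delta>"
    and small: "\<And>n y. y \<in> dom (A\<^sub>n n) \<Longrightarrow> P\<^sub>n n S' y = y \<Longrightarrow>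
      (norm (n.op n y - w *\<^sub>C y))\<^sup>2 \<le> q * (norm (n.op n y - z *\<^sub>C y))\<^sup>2"
    and large: "\<And>y. y \<in> dom A \<Longrightarrow> P S y = y \<Longrightarrow>
      (q + \<delta>) * (norm (a.op y - z *\<^sub>C y))\<^sup>2 \<le> (norm (a.op y - w *\<^sub>C y))\<^sup>2"
    and \<psi>: "P S \<psi> = \<psi>"
  shows "(\<lambda>n. P\<^sub>n n S' (J n \<psi>)) \<longlonglongrightarrow> 0"
proof -
  define \<kappa> where "\<kappa> = sqrt q"
  define \<theta> where "\<theta> = sqrt (q / (q + \<delta>))"
  have "\<kappa> > 0" using \<open>0 < q\<close> by (simp add: \<kappa>_def)
  have \<theta>: "0 \<le> \<theta>" "\<theta> < 1" using \<open>0 < q\<close> \<open>0 < \<delta>\<close> by (simp_all add: \<theta>_def)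
  have "(\<lambda>n. norm (P\<^sub>n n S' (J n \<psi>))) \<longlonglongrightarrow> 0"
  proof (rule iterated_contraction_tendsto_zero[where V = "{x. P S x = x}"])
    show "norm (P\<^sub>n n S' (J n x)) \<le> C * norm x" for n x
      using n.norm_P_le[OF S' J_range] norm_J_le order_trans by blast
    show "0 \<le> C" "0 < \<kappa>" "0 \<le> \<theta>" "\<theta> < 1" "\<psi> \<in> {x. P S x = x}"
      using C \<open>\<kappa> > 0\<close> \<theta> \<psi> by auto
    fix x assume "x \<in> {x. P S x = x}"
    then obtain y where y: "y \<in> dom A" "P S y = y" "a.op y - w *\<^sub>C y = x"
      using a.near_resolvent_set_surj[OF z(1) w _ S] by blast
    \<comment> \<open>\<open>\<phi>\<close> is the preimage of \<open>x\<close> under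
      \<open>T\<close>; it is the vector to which the iteration passes, and \<open>large\<close>
      bounds it by \<open>x\<close>.\<close>
    define \<phi> where "\<phi> = a.op y - z *\<^sub>C y"
    have y_eq: "y = resolvent A z \<phi>" unfolding \<phi>_def using a.resolvent_op[OF z(1) y(1)] by simp
    have x_eq: "x = \<phi> + (z - w) *\<^sub>C resolvent A z \<phi>"
      unfolding y_eq[symmetric] unfolding y(3)[symmetric] \<phi>_def
      by (simp add: complex_vec.scale_left_diff_distrib)
    have "P S \<phi> = \<phi>"
      unfolding \<phi>_def using a.op_P[OF y(1) S] y S by (simp add: a.P_diff a.P_scaleC)
    moreover have "\<kappa> * norm \<phi> \<le> \<theta> * norm x"
    proof (rule power2_le_imp_le)
      have "q * (norm \<phi>)\<^sup>2 = q / (q + \<delta>) * ((q + \<delta>) * (norm \<phi>)\<^sup>2)" using \<open>0 < q\<close> \<open>0 < \<delta>\<close> by simp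
      also have "\<dots> \<le> q / (q + \<delta>) * (norm x)\<^sup>2"
        using large[OF y(1,2)] y(3) \<open>0 < q\<close> \<open>0 < \<delta>\<close> by (intro mult_left_mono) (auto simp: \<phi>_def)
      finally show "(\<kappa> * norm \<phi>)\<^sup>2 \<le> (\<theta> * norm x)\<^sup>2"
        using \<open>0 < q\<close> \<open>0 < \<delta>\<close> by (simp add: \<kappa>_def \<theta>_def power_mult_distrib)
    qed (use \<theta> in simp)
    moreover have "\<exists>e. e \<longlonglongrightarrow> 0 \<and> (\<forall>n. norm (P\<^sub>n n S' (J n x)) \<le> \<kappa> * norm (P\<^sub>n n S' (J n \<phi>)) + e n)"
    proof (intro exI conjI allI)
      \<comment> \<open>The intertwining defect at \<open>\<phi>\<close> is the only source of the
        error \<open>e\<close>.\<close>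
      define r where "r n = J n (resolvent A z \<phi>) - resolvent (A\<^sub>n n) z (J n \<phi>)" for n
      show "(\<lambda>n. norm ((z - w) *\<^sub>C r n)) \<longlonglongrightarrow> 0"
        using tendsto_mult_right_zero[OF tendsto_norm_zero[OF resolvent_intertwining[of \<phi>]], of "cmod (z - w)"]
        by (simp add: r_def norm_scaleC)
      fix n
      define R where "R = resolvent (A\<^sub>n n) z (J n \<phi>)"
      \<comment> \<open>\<open>t\<close> lies in the range of \<open>P\<^sub>n n S'\<close>, so
        \<open>small\<close> applies to it, and by \<open>op_P\<close> the projection carries each
        shift of \<open>R\<close> to the same shift of \<open>t\<close>.\<close>
      define t where "t = P\<^sub>n n S' R"
      have R: "R \<in> H\<^sub>n n" "R \<in> dom (A\<^sub>n n)"
        unfolding R_def using n.resolvent_H[OF z(2) J_range] n.resolvent_dom[OF z(2) J_range] by auto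
      have rH: "(z - w) *\<^sub>C r n \<in> H\<^sub>n n"
        using R J_range by (auto simp: r_def R_def intro!: n.H_scaleC n.H_diff)
      have JR: "J n \<phi> = n.op n R - z *\<^sub>C R"
        unfolding R_def using n.op_resolvent[OF z(2) J_range] by simp
      have t: "t \<in> dom (A\<^sub>n n)" "P\<^sub>n n S' t = t"
        unfolding t_def using R S' by (simp_all add: n.P_dom n.P_idem)
      have P_shift: "P\<^sub>n n S' (n.op n R - c *\<^sub>C R) = n.op n t - c *\<^sub>C t" for c
        unfolding t_def using R S' by (simp add: n.P_diff n.P_scaleC n.op_P n.op_H n.H_scaleC)
      have "J n x = J n \<phi> + (z - w) *\<^sub>C (r n + R)"
        unfolding x_eq r_def R_def by (simp add: J_add J_scaleC)
      also have "\<dots> = (n.op n R - w *\<^sub>C R) + (z - w) *\<^sub>C r n"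
        unfolding JR by (simp add: scaleC_add_right complex_vec.scale_left_diff_distrib)
      finally have "P\<^sub>n n S' (J n x) = (n.op n t - w *\<^sub>C t) + P\<^sub>n n S' ((z - w) *\<^sub>C r n)"
        using R rH S' by (simp add: n.P_add P_shift n.H_diff n.op_H n.H_scaleC)
      then have "norm (P\<^sub>n n S' (J n x)) \<le> norm (n.op n t - w *\<^sub>C t) + norm ((z - w) *\<^sub>C r n)"
        using norm_triangle_ineq[of "n.op n t - w *\<^sub>C t"] n.norm_P_le[OF S' rH]
        by (metis add_left_mono order_trans)
      moreover have "norm (n.op n t - w *\<^sub>C t) \<le> \<kappa> * norm (n.op n t - z *\<^sub>C t)"
        by (rule power2_le_imp_le)
           (use small[OF t] \<open>0 < q\<close> in \<open>auto simp: \<kappa>_def power_mult_distrib\<close>)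
      moreover have "n.op n t - z *\<^sub>C t = P\<^sub>n n S' (J n \<phi>)" unfolding JR P_shift ..
      ultimately show "norm (P\<^sub>n n S' (J n x)) \<le> \<kappa> * norm (P\<^sub>n n S' (J n \<phi>)) + norm ((z - w) *\<^sub>C r n)"
        by simp
    qed
    ultimately show "\<exists>y\<in>{x. P S x = x}. \<kappa> * norm y \<le> \<theta> * norm x \<and>
        (\<exists>e. e \<longlonglongrightarrow> 0 \<and> (\<forall>n. norm (P\<^sub>n n S' (J n x)) \<le> \<kappa> * norm (P\<^sub>n n S' (J n y)) + e n))"
      by (intro bexI[of _ \<phi>]) auto
  qed simp
  then show ?thesis by (rule tendsto_norm_zero_cancel)
qed

section \<open>Transfer of spectral localisation to the sequence\<close>

lemma mobius_z:
  obtains \<alpha> where "z = Complex (m + \<alpha>) (Im z)"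
  using that[of "Re z - m"] by (simp add: complex_eq_iff)

text \<open>With \<open>q < 1\<close> the additional term of \<open>norm_mobius\<close> is
  nonpositive for spectrum within distance \<open>d\<close> of \<open>m\<close>, which gives
  \<open>small\<close>, while spectrum beyond \<open>d'\<close> gives \<open>large\<close>.\<close>

lemma transfer_outside:
  assumes d: "0 \<le> d" "d < d'" and S: "S \<in> sets borel" "S \<subseteq> {t. d' \<le> \<bar>t - m\<bar>}" "P S \<psi> = \<psi>"
  shows "(\<lambda>n. P\<^sub>n n {t. \<bar>t - m\<bar> \<le> d} (J n \<psi>)) \<longlonglongrightarrow> 0"
proof -
  obtain \<alpha> where \<alpha>: "z = Complex (m + \<alpha>) (Im z)" by (rule mobius_z)
  have "\<forall>\<^sub>F q in at_left 1. \<exists>\<beta>. \<beta>\<^sup>2 = q * (1 - q) * \<alpha>\<^sup>2 + q * (Im z)\<^sup>2 - (1 - q) * d\<^sup>2 \<and>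
      cmod (Complex (m + q * \<alpha>) \<beta> - Complex (m + \<alpha>) (Im z)) < \<bar>Im z\<bar>"
    by (rule filter_leD[OF at_le mobius_parameter[OF z(3)]]) simp
  moreover have "\<forall>\<^sub>F q in at_left 1. (0::real) < q \<and> q < 1"
    using eventually_at_left_real[of 0 "1::real"] by (auto elim: eventually_mono)
  ultimately have "\<forall>\<^sub>F q in at_left 1. (\<exists>\<beta>. \<beta>\<^sup>2 = q * (1 - q) * \<alpha>\<^sup>2 + q * (Im z)\<^sup>2 - (1 - q) * d\<^sup>2 \<and>
      cmod (Complex (m + q * \<alpha>) \<beta> - Complex (m + \<alpha>) (Im z)) < \<bar>Im z\<bar>) \<and> 0 < q \<and> q < 1"
    by (rule eventually_conj)
  from eventually_happens'[OF trivial_limit_at_left_real this]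
  obtain q \<beta> where q: "0 < q" "q < 1"
      and \<beta>: "\<beta>\<^sup>2 = q * (1 - q) * \<alpha>\<^sup>2 + q * (Im z)\<^sup>2 - (1 - q) * d\<^sup>2"
        "cmod (Complex (m + q * \<alpha>) \<beta> - Complex (m + \<alpha>) (Im z)) < \<bar>Im z\<bar>"
    by blast
  define w where "w = Complex (m + q * \<alpha>) \<beta>"
  have S': "{t. \<bar>t - m\<bar> \<le> d} \<in> sets borel" by simp
  obtain \<delta> where \<delta>: "\<delta> > 0" "\<And>S y. \<lbrakk>y \<in> dom A; S \<in> sets borel; P S y = y; S \<subseteq> {t. d' \<le> \<bar>t - m\<bar>}\<rbrakk> \<Longrightarrow>
      (q + \<delta>) * (norm (a.op y - z *\<^sub>C y))\<^sup>2 \<le> (norm (a.op y - w *\<^sub>C y))\<^sup>2"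
    by (rule a.mobius_expands_outside[OF \<beta>(1) q(2) d, where m = m, unfolded \<alpha>[symmetric], folded w_def])
       blast
  show ?thesis
  proof (rule spectral_transfer[OF S(1) S' _ q(1) \<delta>(1) _ _ S(3)])
    show "cmod (w - z) < \<bar>Im z\<bar>" using \<beta>(2) unfolding w_def \<alpha>[symmetric] .
    show "(q + \<delta>) * (norm (a.op y - z *\<^sub>C y))\<^sup>2 \<le> (norm (a.op y - w *\<^sub>C y))\<^sup>2"
      if "y \<in> dom A" "P S y = y" for y
      by (rule \<delta>(2)[OF that(1) S(1) that(2) S(2)])
    fix n y assume y: "y \<in> dom (A\<^sub>n n)" "P\<^sub>n n {t. \<bar>t - m\<bar> \<le> d} y = y"
    have "norm (n.op n y - m *\<^sub>R y) \<le> d * norm y"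
      by (rule n.norm_op_le[OF n.dom_H[OF y(1)] S' y(2)]) (use d in auto)
    then have "(norm (n.op n y - m *\<^sub>R y))\<^sup>2 \<le> (d * norm y)\<^sup>2"
      by (rule power_mono) simp
    then have "(1 - q) * ((norm (n.op n y - m *\<^sub>R y))\<^sup>2 - d\<^sup>2 * (norm y)\<^sup>2) \<le> 0"
      using q by (simp add: mult_le_0_iff power_mult_distrib)
    then show "(norm (n.op n y - w *\<^sub>C y))\<^sup>2 \<le> q * (norm (n.op n y - z *\<^sub>C y))\<^sup>2"
      using n.norm_mobius[OF y(1) \<beta>(1), of m] unfolding w_def \<alpha>[symmetric] by linarith
  qed
qed

text \<open>With \<open>q > 1\<close> the signs reverse: the far set now supplies
  \<open>small\<close>, and the interval of radius \<open>d'\<close> supplies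
  \<open>large\<close>.\<close>

lemma transfer_inside:
  assumes d: "0 \<le> d'" "d' < d" and S: "S \<in> sets borel" "S \<subseteq> {t. \<bar>t - m\<bar> \<le> d'}" "P S \<psi> = \<psi>"
  shows "(\<lambda>n. P\<^sub>n n {t. d \<le> \<bar>t - m\<bar>} (J n \<psi>)) \<longlonglongrightarrow> 0"
proof -
  obtain \<alpha> where \<alpha>: "z = Complex (m + \<alpha>) (Im z)" by (rule mobius_z)
  have "\<forall>\<^sub>F q in at_right 1. \<exists>\<beta>. \<beta>\<^sup>2 = q * (1 - q) * \<alpha>\<^sup>2 + q * (Im z)\<^sup>2 - (1 - q) * d\<^sup>2 \<and>
      cmod (Complex (m + q * \<alpha>) \<beta> - Complex (m + \<alpha>) (Im z)) < \<bar>Im z\<bar>"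
    by (rule filter_leD[OF at_le mobius_parameter[OF z(3)]]) simp
  moreover have "\<forall>\<^sub>F q in at_right 1. (1::real) < q"
    by (simp add: eventually_at_right_less)
  ultimately have "\<forall>\<^sub>F q in at_right 1. (\<exists>\<beta>. \<beta>\<^sup>2 = q * (1 - q) * \<alpha>\<^sup>2 + q * (Im z)\<^sup>2 - (1 - q) * d\<^sup>2 \<and>
      cmod (Complex (m + q * \<alpha>) \<beta> - Complex (m + \<alpha>) (Im z)) < \<bar>Im z\<bar>) \<and> 1 < q"
    by (rule eventually_conj)
  from eventually_happens'[OF trivial_limit_at_right_real this]
  obtain q \<beta> where q: "1 < q"
      and \<beta>: "\<beta>\<^sup>2 = q * (1 - q) * \<alpha>\<^sup>2 + q * (Im z)\<^sup>2 - (1 - q) * d\<^sup>2"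
        "cmod (Complex (m + q * \<alpha>) \<beta> - Complex (m + \<alpha>) (Im z)) < \<bar>Im z\<bar>"
    by blast
  define w where "w = Complex (m + q * \<alpha>) \<beta>"
  have S': "{t. d \<le> \<bar>t - m\<bar>} \<in> sets borel" by simp
  obtain \<delta> where \<delta>: "\<delta> > 0" "\<And>S y. \<lbrakk>y \<in> dom A; S \<in> sets borel; P S y = y; S \<subseteq> {t. \<bar>t - m\<bar> \<le> d'}\<rbrakk> \<Longrightarrow>
      (q + \<delta>) * (norm (a.op y - z *\<^sub>C y))\<^sup>2 \<le> (norm (a.op y - w *\<^sub>C y))\<^sup>2"
    by (rule a.mobius_expands_inside[OF \<beta>(1) q d, where m = m, unfolded \<alpha>[symmetric], folded w_def])
       blast
  have "0 < q" using q by simp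
  show ?thesis
  proof (rule spectral_transfer[OF S(1) S' _ \<open>0 < q\<close> \<delta>(1) _ _ S(3)])
    show "cmod (w - z) < \<bar>Im z\<bar>" using \<beta>(2) unfolding w_def \<alpha>[symmetric] .
    show "(q + \<delta>) * (norm (a.op y - z *\<^sub>C y))\<^sup>2 \<le> (norm (a.op y - w *\<^sub>C y))\<^sup>2"
      if "y \<in> dom A" "P S y = y" for y
      by (rule \<delta>(2)[OF that(1) S(1) that(2) S(2)])
    fix n y assume y: "y \<in> dom (A\<^sub>n n)" "P\<^sub>n n {t. d \<le> \<bar>t - m\<bar>} y = y"
    have "d * norm y \<le> norm (n.op n y - m *\<^sub>R y)"
      by (rule n.norm_op_ge[OF y(1) S' y(2)]) (use d in auto)
    then have "(d * norm y)\<^sup>2 \<le> (norm (n.op n y - m *\<^sub>R y))\<^sup>2"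
      by (rule power_mono) (use d in simp)
    then have "(1 - q) * ((norm (n.op n y - m *\<^sub>R y))\<^sup>2 - d\<^sup>2 * (norm y)\<^sup>2) \<le> 0"
      using q by (simp add: mult_le_0_iff power_mult_distrib)
    then show "(norm (n.op n y - w *\<^sub>C y))\<^sup>2 \<le> q * (norm (n.op n y - z *\<^sub>C y))\<^sup>2"
      using n.norm_mobius[OF y(1) \<beta>(1), of m] unfolding w_def \<alpha>[symmetric] by linarith
  qed
qed

section \<open>Intervals with endpoints that are not eigenvalues\<close>

context
  fixes m d :: real
  assumes d: "0 < d" and endpoints: "P {m - d} = (\<lambda>\<psi>. 0)" "P {m + d} = (\<lambda>\<psi>. 0)"
begin

lemma P_endpoints: "P {m - d, m + d} \<psi> = 0"
  using a.P_Un[of "{m - d}" "{m + d}" \<psi>] d endpoints by (simp add: insert_commute)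

lemma P_open_eq_closed: "P {m - d<..<m + d} = P {m - d..m + d}"
proof
  fix \<psi>
  have "{m - d..m + d} = {m - d<..<m + d} \<union> {m - d, m + d}" using d by auto
  then show "P {m - d<..<m + d} \<psi> = P {m - d..m + d} \<psi>"
    using a.P_Un[of "{m - d<..<m + d}" "{m - d, m + d}" \<psi>] by (simp add: P_endpoints)
qed

text \<open>The omitted sets decrease to the two endpoints, which have spectral measure zero, so
  continuity from above of the finite measure applies.\<close>

lemma approximation_away_from_endpoints:
  "(\<lambda>k. P {t. \<bar>t - m\<bar> \<le> d - d / Suc k} \<psi> + P {t. d + d / Suc k \<le> \<bar>t - m\<bar>} \<psi>) \<longlonglongrightarrow> \<psi>"
    (is "(\<lambda>k. P (?I k) \<psi> + P (?O k) \<psi>) \<longlonglongrightarrow> \<psi>")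
proof -
  interpret finite_measure "a.\<mu> \<psi>" by (rule a.finite_measure_\<mu>) simp
  define F where "F k = - (?I k \<union> ?O k)" for k
  have meas: "?I k \<in> sets borel" "?O k \<in> sets borel" for k by simp_all
  then have F: "F k \<in> sets borel" for k unfolding F_def by (intro borel_comp sets.Un)
  have "decseq F"
  proof (rule decseq_SucI)
    fix k
    have "d / Suc (Suc k) \<le> d / Suc k" using d by (intro divide_left_mono) auto
    then show "F (Suc k) \<subseteq> F k" by (auto simp: F_def)
  qed
  then have "(\<lambda>k. measure (a.\<mu> \<psi>) (F k)) \<longlonglongrightarrow> measure (a.\<mu> \<psi>) (\<Inter>k. F k)"
    using F by (intro finite_Lim_measure_decseq) auto
  moreover have "(\<Inter>k. F k) = {m - d, m + d}"
  proof
    show "(\<Inter>k. F k) \<subseteq> {m - d, m + d}"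
    proof
      fix t assume t: "t \<in> (\<Inter>k. F k)"
      have "\<bar>\<bar>t - m\<bar> - d\<bar> \<le> 0"
      proof (rule LIMSEQ_le_const)
        show "(\<lambda>k. d / Suc k) \<longlonglongrightarrow> 0"
          using tendsto_mult_right_zero[OF LIMSEQ_inverse_real_of_nat, of d]
          by (simp add: divide_inverse)
        have "\<bar>\<bar>t - m\<bar> - d\<bar> \<le> d / Suc k" for k
        proof -
          have "t \<in> F k" using t by blast
          then show ?thesis by (auto simp: F_def)
        qed
        then show "\<exists>N. \<forall>k\<ge>N. \<bar>\<bar>t - m\<bar> - d\<bar> \<le> d / Suc k" by blast
      qed
      then show "t \<in> {m - d, m + d}" by auto
    qed
    have "m - d \<in> F k \<and> m + d \<in> F k" for k
    proof -
      define e where "e = d / Suc k"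
      have "0 < e" using d by (simp add: e_def)
      then show ?thesis using d unfolding F_def e_def[symmetric] by auto
    qed
    then show "{m - d, m + d} \<subseteq> (\<Inter>k. F k)" by auto
  qed
  ultimately have "(\<lambda>k. (norm (P (F k) \<psi>))\<^sup>2) \<longlonglongrightarrow> 0"
    using F by (simp add: a.measure_\<mu> P_endpoints)
  from tendsto_real_sqrt[OF this] have "(\<lambda>k. norm (P (F k) \<psi>)) \<longlonglongrightarrow> 0" by simp
  then have "(\<lambda>k. \<psi> - P (F k) \<psi>) \<longlonglongrightarrow> \<psi> - 0"
    by (intro tendsto_diff[OF tendsto_const]) (rule tendsto_norm_zero_cancel)
  moreover have "\<psi> - P (F k) \<psi> = P (?I k) \<psi> + P (?O k) \<psi>" for k
  proof -
    define e where "e = d / Suc k"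
    have "0 < e" using d by (simp add: e_def)
    then have "?I k \<inter> ?O k = {}" unfolding e_def[symmetric] by auto
    then have "P (?I k \<union> ?O k) \<psi> = P (?I k) \<psi> + P (?O k) \<psi>" by (intro a.P_Un meas) auto
    moreover have "P (F k) \<psi> = \<psi> - P (?I k \<union> ?O k) \<psi>"
      unfolding F_def by (intro a.P_Compl sets.Un meas) auto
    ultimately show ?thesis by simp
  qed
  ultimately show ?thesis by simp
qed

context
  fixes S :: "real set"
  assumes S: "S \<in> sets borel" "{m - d<..<m + d} \<subseteq> S" "S \<subseteq> {m - d..m + d}"
begin

text \<open>Here the limit projection fixes \<open>\<psi>\<close>, so the difference is minus the
  \<open>- S\<close> part of \<open>J n \<psi>\<close>. As \<open>- S\<close> misses the open
  interval, \<open>transfer_inside\<close> makes that part vanish.\<close>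

lemma intertwining_inside:
  assumes "P {t. \<bar>t - m\<bar> \<le> d - d / Suc k} \<psi> = \<psi>"
  shows "(\<lambda>n. P\<^sub>n n S (J n \<psi>) - J n (P {m - d<..<m + d} \<psi>)) \<longlonglongrightarrow> 0"
proof -
  let ?E = "{t. d \<le> \<bar>t - m\<bar>}"
  have dk: "0 \<le> d - d / Suc k" "d - d / Suc k < d" using d by (simp_all add: field_simps)
  have S': "- S \<in> sets borel" using S(1) by (rule borel_comp)
  have E: "?E \<in> sets borel" by simp
  have "(\<lambda>n. P\<^sub>n n ?E (J n \<psi>)) \<longlonglongrightarrow> 0"
    by (rule transfer_inside[OF dk _ order_refl assms]) simp
  then have "(\<lambda>n. norm (P\<^sub>n n ?E (J n \<psi>))) \<longlonglongrightarrow> 0" by (rule tendsto_norm_zero)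
  then have lim: "(\<lambda>n. P\<^sub>n n (- S) (J n \<psi>)) \<longlonglongrightarrow> 0"
  proof (rule Lim_null_comparison[rotated])
    have "d \<le> \<bar>t - m\<bar>" if "t \<notin> S" for t
    proof -
      have "t \<notin> {m - d<..<m + d}" using S(2) that by blast
      then show ?thesis by auto
    qed
    then have "- S \<inter> ?E = - S" by auto
    then have "P\<^sub>n n (- S) (J n \<psi>) = P\<^sub>n n (- S) (P\<^sub>n n ?E (J n \<psi>))" for n
      using n.P_Int[OF S' E J_range] by simp
    then show "\<forall>\<^sub>F n in sequentially. norm (P\<^sub>n n (- S) (J n \<psi>)) \<le> norm (P\<^sub>n n ?E (J n \<psi>))"
      using n.norm_P_le[OF S' n.P_H[OF E J_range]] by simp
  qed
  have "P {m - d<..<m + d} \<psi> = \<psi>"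
    by (rule a.P_mono[OF _ _ _ _ assms]) (use dk in auto)
  then have "P\<^sub>n n S (J n \<psi>) - J n (P {m - d<..<m + d} \<psi>) = - P\<^sub>n n (- S) (J n \<psi>)" for n
    using S by (simp add: n.P_Compl J_range)
  then show ?thesis using tendsto_minus[OF lim] by simp
qed

text \<open>Here the limit projection annihilates \<open>\<psi>\<close>, and since \<open>S\<close>
  lies in the closed interval, \<open>transfer_outside\<close> handles the remaining term.\<close>

lemma intertwining_outside:
  assumes "P {t. d + d / Suc k \<le> \<bar>t - m\<bar>} \<psi> = \<psi>"
  shows "(\<lambda>n. P\<^sub>n n S (J n \<psi>) - J n (P {m - d<..<m + d} \<psi>)) \<longlonglongrightarrow> 0"
proof -
  let ?E = "{t. \<bar>t - m\<bar> \<le> d}" and ?O = "{t. d + d / Suc k \<le> \<bar>t - m\<bar>}"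
  have dk: "0 \<le> d" "d < d + d / Suc k" using d by simp_all
  have E: "?E \<in> sets borel" by simp
  have "(\<lambda>n. P\<^sub>n n ?E (J n \<psi>)) \<longlonglongrightarrow> 0"
    by (rule transfer_outside[OF dk _ order_refl assms]) simp
  then have "(\<lambda>n. norm (P\<^sub>n n ?E (J n \<psi>))) \<longlonglongrightarrow> 0" by (rule tendsto_norm_zero)
  then have "(\<lambda>n. P\<^sub>n n S (J n \<psi>)) \<longlonglongrightarrow> 0"
  proof (rule Lim_null_comparison[rotated])
    have "S \<inter> ?E = S" using S(3) by (auto simp: abs_le_iff)
    then have "P\<^sub>n n S (J n \<psi>) = P\<^sub>n n S (P\<^sub>n n ?E (J n \<psi>))" for n
      using n.P_Int[OF S(1) E J_range] by simp
    then show "\<forall>\<^sub>F n in sequentially. norm (P\<^sub>n n S (J n \<psi>)) \<le> norm (P\<^sub>n n ?E (J n \<psi>))"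
      using n.norm_P_le[OF S(1) n.P_H[OF E J_range]] by simp
  qed
  moreover have "\<not> d + d / Suc k \<le> \<bar>t - m\<bar>" if "t \<in> {m - d<..<m + d}" for t
    using that dk(2) unfolding greaterThanLessThan_iff by linarith
  then have "{m - d<..<m + d} \<inter> ?O = {}" by blast
  then have "P {m - d<..<m + d} (P ?O \<psi>) = 0"
    by (intro a.P_disjoint) simp_all
  \<comment> \<open>\<open>J_diff\<close> at zero supplies \<open>J n 0 = 0\<close>.\<close>
  ultimately show ?thesis using assms J_diff[of _ 0 0] by simp
qed

text \<open>The defect is additive and bounded by \<open>2 * C\<close> uniformly in
  \<open>n\<close>, so convergence on the approximants of
  \<open>approximation_away_from_endpoints\<close> extends to every vector.\<close>

lemma spectral_projection_intertwining:
  "(\<lambda>n. P\<^sub>n n S (J n \<psi>) - J n (P {m - d<..<m + d} \<psi>)) \<longlonglongrightarrow> 0"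
proof -
  define g where "g n x = P\<^sub>n n S (J n x) - J n (P {m - d<..<m + d} x)" for n x
  have I: "{m - d<..<m + d} \<in> sets borel" by simp
  have g_add: "g n (x + y) = g n x + g n y" for n x y
    using S(1) by (simp add: g_def J_add n.P_add J_range a.P_add)
  have g_diff: "g n (x - y) = g n x - g n y" for n x y
    using S(1) by (simp add: g_def J_diff n.P_diff J_range a.P_diff)
  have g_le: "norm (g n x) \<le> 2 * C * norm x" for n x
  proof -
    have "norm (P\<^sub>n n S (J n x)) \<le> C * norm x"
      using n.norm_P_le[OF S(1) J_range] norm_J_le order_trans by blast
    moreover have "norm (J n (P {m - d<..<m + d} x)) \<le> C * norm x"
      using norm_J_le a.norm_P_le[OF I, of x] C(1) by (meson UNIV_I mult_left_mono less_imp_le order_trans)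
    ultimately show ?thesis
      using norm_triangle_ineq4[of "P\<^sub>n n S (J n x)" "J n (P {m - d<..<m + d} x)"]
      unfolding g_def by linarith
  qed
  define \<phi> where "\<phi> k = P {t. \<bar>t - m\<bar> \<le> d - d / Suc k} \<psi> + P {t. d + d / Suc k \<le> \<bar>t - m\<bar>} \<psi>" for k
  have g_\<phi>: "(\<lambda>n. g n (\<phi> k)) \<longlonglongrightarrow> 0" for k
  proof -
    have "(\<lambda>n. g n (P {t. \<bar>t - m\<bar> \<le> d - d / Suc k} \<psi>)) \<longlonglongrightarrow> 0"
      unfolding g_def by (rule intertwining_inside, rule a.P_idem) simp_all
    moreover have "(\<lambda>n. g n (P {t. d + d / Suc k \<le> \<bar>t - m\<bar>} \<psi>)) \<longlonglongrightarrow> 0"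
      unfolding g_def by (rule intertwining_outside, rule a.P_idem) simp_all
    ultimately show ?thesis unfolding \<phi>_def g_add by (rule tendsto_add_zero)
  qed
  have "(\<lambda>n. g n \<psi>) \<longlonglongrightarrow> 0"
  proof (rule tendstoI)
    fix e :: real assume "e > 0"
    have "(\<lambda>k. 2 * C * norm (\<psi> - \<phi> k)) \<longlonglongrightarrow> 2 * C * norm (\<psi> - \<psi>)"
      unfolding \<phi>_def
      by (intro tendsto_mult_left tendsto_norm tendsto_diff tendsto_const approximation_away_from_endpoints)
    then have "\<forall>\<^sub>F k in sequentially. 2 * C * norm (\<psi> - \<phi> k) < e / 2"
      by (rule order_tendstoD(2)) (use \<open>e > 0\<close> in simp)
    then obtain k where k: "2 * C * norm (\<psi> - \<phi> k) < e / 2" by (auto simp: eventually_sequentially)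
    have "\<forall>\<^sub>F n in sequentially. norm (g n (\<phi> k)) < e / 2"
      by (rule order_tendstoD(2)[OF tendsto_norm_zero[OF g_\<phi>]]) (use \<open>e > 0\<close> in simp)
    then show "\<forall>\<^sub>F n in sequentially. dist (g n \<psi>) 0 < e"
    proof eventually_elim
      case (elim n)
      have "g n \<psi> = g n (\<psi> - \<phi> k) + g n (\<phi> k)" by (simp add: g_diff)
      then have "norm (g n \<psi>) \<le> norm (g n (\<psi> - \<phi> k)) + norm (g n (\<phi> k))"
        by (simp only: norm_triangle_ineq)
      then show ?case using g_le[of n "\<psi> - \<phi> k"] k elim by simp
    qed
  qed
  then show ?thesis unfolding g_def .
qed

text \<open>The adjoints are bounded by \<open>C\<close>, so they preserve the null sequence of
  \<open>spectral_projection_intertwining\<close>; \<open>J_adj\<close> then removes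
  \<open>J n\<close>.\<close>

lemma spectral_projection_strong_limit:
  "strong_limit (\<lambda>n \<psi>. cadjoint (J n) (P\<^sub>n n S (J n \<psi>))) (P {m - d<..<m + d})"
  unfolding strong_limit_def
proof
  fix \<psi>
  define g where "g n = P\<^sub>n n S (J n \<psi>) - J n (P {m - d<..<m + d} \<psi>)" for n
  have "(\<lambda>n. cadjoint (J n) (g n)) \<longlonglongrightarrow> 0"
  proof (rule Lim_null_comparison)
    show "\<forall>\<^sub>F n in sequentially. norm (cadjoint (J n) (g n)) \<le> C * norm (g n)"
      using norm_cadjoint_le[OF J norm_J_le] C(1) by simp
    show "(\<lambda>n. C * norm (g n)) \<longlonglongrightarrow> 0"
      unfolding g_def
      by (intro tendsto_mult_right_zero tendsto_norm_zero spectral_projection_intertwining)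
  qed
  then have "(\<lambda>n. cadjoint (J n) (g n) + cadjoint (J n) (J n (P {m - d<..<m + d} \<psi>)))
      \<longlonglongrightarrow> 0 + P {m - d<..<m + d} \<psi>"
    by (intro tendsto_add J_adj)
  then show "(\<lambda>n. cadjoint (J n) (P\<^sub>n n S (J n \<psi>))) \<longlonglongrightarrow> P {m - d<..<m + d} \<psi>"
    by (simp add: g_def cadjoint_add[OF J, symmetric])
qed

end

end

text \<open>The quotients \<open>(norm (J n x))\<^sup>2 / (norm x)\<^sup>2\<close> tend to 1 and lie
  below the squared operator norms.\<close>

lemma one_le_limsup_onorm:
  assumes "(x::'a) \<noteq> 0"
  shows "1 \<le> limsup (\<lambda>n. ereal ((onorm (J n))\<^sup>2))"
proof -
  have "(\<lambda>n. (norm (J n x))\<^sup>2 / (norm x)\<^sup>2) \<longlonglongrightarrow> (norm x)\<^sup>2 / (norm x)\<^sup>2"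
    by (intro tendsto_divide norm_J_tendsto tendsto_const) (use assms in simp)
  then have "(\<lambda>n. ereal ((norm (J n x))\<^sup>2 / (norm x)\<^sup>2)) \<longlonglongrightarrow> ereal 1"
    using assms by simp
  then have "limsup (\<lambda>n. ereal ((norm (J n x))\<^sup>2 / (norm x)\<^sup>2)) = ereal 1"
    by (intro lim_imp_Limsup) simp_all
  moreover have "limsup (\<lambda>n. ereal ((norm (J n x))\<^sup>2 / (norm x)\<^sup>2)) \<le> limsup (\<lambda>n. ereal ((onorm (J n))\<^sup>2))"
  proof (intro Limsup_mono always_eventually allI)
    fix n
    have "(norm (J n x))\<^sup>2 \<le> (onorm (J n) * norm x)\<^sup>2"
      by (intro power_mono onorm J_linear norm_ge_zero)
    then show "ereal ((norm (J n x))\<^sup>2 / (norm x)\<^sup>2) \<le> ereal ((onorm (J n))\<^sup>2)"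
      using assms by (simp add: power_mult_distrib divide_le_eq)
  qed
  ultimately show ?thesis by (simp add: one_ereal_def)
qed

text \<open>The compression has its range in the image of the spectral subspace under the linear map
  \<open>cadjoint (J n)\<close>.\<close>

lemma cdim_compression_le:
  "cdim (range (\<lambda>\<psi>. cadjoint (J n) (P\<^sub>n n S (J n \<psi>)))) \<le> cdim (P\<^sub>n n S ` H\<^sub>n n)"
proof -
  have "cdim (range (\<lambda>\<psi>. cadjoint (J n) (P\<^sub>n n S (J n \<psi>)))) \<le> cdim (cadjoint (J n) ` P\<^sub>n n S ` H\<^sub>n n)"
    by (rule cdim_mono) (use J_range in auto)
  also have "\<dots> \<le> cdim (P\<^sub>n n S ` H\<^sub>n n)"
    by (rule cdim_image_le[OF cadjoint_add[OF J] cadjoint_scaleC[OF J]])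
  finally show ?thesis .
qed

lemma liminf_cdim_compression_le:
  "ereal_of_enat (liminf (\<lambda>n. cdim (range (\<lambda>\<psi>. cadjoint (J n) (P\<^sub>n n S (J n \<psi>)))))) \<le>
    limsup (\<lambda>n. ereal ((onorm (J n))\<^sup>2)) * ereal_of_enat (liminf (\<lambda>n. cdim (P\<^sub>n n S ` H\<^sub>n n)))"
    (is "ereal_of_enat ?l \<le> ?L * ereal_of_enat ?r")
proof (cases "\<exists>x::'a. x \<noteq> 0")
  case True
  then have "1 \<le> ?L" using one_le_limsup_onorm by blast
  have "?l \<le> ?r" by (intro Liminf_mono always_eventually allI cdim_compression_le)
  then have "ereal_of_enat ?l \<le> 1 * ereal_of_enat ?r" by simp
  also have "\<dots> \<le> ?L * ereal_of_enat ?r"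
    by (intro ereal_mult_right_mono \<open>1 \<le> ?L\<close>) simp
  finally show ?thesis .
next
  case False
  \<comment> \<open>On the trivial space the left-hand side is zero, so nonnegativity of the limsup
    suffices in place of the bound by 1.\<close>
  then have "cdim X = 0" for X :: "'a set"
    by (intro cdim_eq_0) auto
  then have "?l = 0" by (simp add: Liminf_const)
  moreover have "0 \<le> ?L" by (intro le_Limsup always_eventually allI) simp_all
  ultimately show ?thesis by simp
qed

end

theorem lemma2p12:
  fixes H\<^sub>n :: "nat \<Rightarrow> 'b::complex_hilbert set"
    and J :: "nat \<Rightarrow> 'a::complex_hilbert \<Rightarrow> 'b"
    and A :: "'a \<rightharpoonup> 'a" and A\<^sub>n :: "nat \<Rightarrow> 'b \<rightharpoonup> 'b"
    and P :: "real set \<Rightarrow> 'a \<Rightarrow> 'a" and P\<^sub>n :: "nat \<Rightarrow> real set \<Rightarrow> 'b \<Rightarrow> 'b"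
    and l\<^sub>0 l\<^sub>1 :: real
  assumes "separable_hilbert (UNIV :: 'a set)"
    and "\<And>n. separable_hilbert (H\<^sub>n n)"
    and "\<And>n. bounded_clinear (J n)" and "\<And>n. range (J n) \<subseteq> H\<^sub>n n"
    and "self_adjoint_in UNIV A" and "\<And>n. self_adjoint_in (H\<^sub>n n) (A\<^sub>n n)"
    and "spectral_projections_of UNIV A P"
    and "\<And>n. spectral_projections_of (H\<^sub>n n) (A\<^sub>n n) (P\<^sub>n n)"
    and "generalized_strong_resolvent_convergence H\<^sub>n J A\<^sub>n A"
    and "l\<^sub>0 < l\<^sub>1"
    and "P {l\<^sub>0} = (\<lambda>\<psi>. 0)" and "P {l\<^sub>1} = (\<lambda>\<psi>. 0)"
  shows "strong_limit (\<lambda>n \<psi>. cadjoint (J n) (P\<^sub>n n {l\<^sub>0<..<l\<^sub>1} (J n \<psi>))) (P {l\<^sub>0<..<l\<^sub>1}) \<and>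
         strong_limit (\<lambda>n \<psi>. cadjoint (J n) (P\<^sub>n n {l\<^sub>0..l\<^sub>1} (J n \<psi>))) (P {l\<^sub>0<..<l\<^sub>1}) \<and>
         P {l\<^sub>0<..<l\<^sub>1} = P {l\<^sub>0..l\<^sub>1} \<and>
         cdim (range (P {l\<^sub>0<..<l\<^sub>1})) \<le>
           liminf (\<lambda>n. cdim (range (\<lambda>\<psi>. cadjoint (J n) (P\<^sub>n n {l\<^sub>0<..<l\<^sub>1} (J n \<psi>))))) \<and>
         ereal_of_enat (liminf (\<lambda>n. cdim (range (\<lambda>\<psi>. cadjoint (J n) (P\<^sub>n n {l\<^sub>0<..<l\<^sub>1} (J n \<psi>)))))) \<le>
           limsup (\<lambda>n. ereal ((onorm (J n))\<^sup>2)) *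
           ereal_of_enat (liminf (\<lambda>n. cdim (P\<^sub>n n {l\<^sub>0<..<l\<^sub>1} ` H\<^sub>n n)))"
proof -
  note convergence = assms(9)[unfolded generalized_strong_resolvent_convergence_def]
  from convergence[THEN conjunct1] obtain C where C: "C > 0" "\<And>n. onorm (J n) \<le> C" by blast
  have J_adj: "(\<lambda>n. norm (cadjoint (J n) (J n \<psi>) - \<psi>)) \<longlonglongrightarrow> 0" for \<psi>
    using convergence by (elim conjE) (rule spec)
  from convergence[THEN conjunct2, THEN conjunct2]
  obtain z where z: "z \<in> common_resolvent_set A H\<^sub>n A\<^sub>n" "Im z \<noteq> 0"
    and res: "\<forall>\<psi>. (\<lambda>n. norm (cadjoint (J n) (resolvent (A\<^sub>n n) z (J n \<psi>)) - resolvent A z \<psi>))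
      \<longlonglongrightarrow> 0"
    by (elim bexE conjE)
  have "z \<notin> closure (spectrum UNIV A \<union> (\<Union>n. spectrum (H\<^sub>n n) (A\<^sub>n n)))"
    using z(1) unfolding common_resolvent_set_def by (rule ComplD)
  then have "z \<notin> spectrum UNIV A \<union> (\<Union>n. spectrum (H\<^sub>n n) (A\<^sub>n n))"
    by (rule contra_subsetD[OF closure_subset])
  then have z': "z \<in> resolvent_set UNIV A" "\<And>n. z \<in> resolvent_set (H\<^sub>n n) (A\<^sub>n n)"
    by (auto simp: spectrum_def)
  interpret resolvent_convergence H\<^sub>n J A A\<^sub>n P P\<^sub>n C z
  proof
    show "hilbert_subspace (UNIV :: 'a set)" "\<And>n. hilbert_subspace (H\<^sub>n n)"
      using assms(1,2) by (simp_all add: separable_hilbert_def)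
    show "J n x \<in> H\<^sub>n n" for n x using assms(4)[of n] by blast
    show "(\<lambda>n. cadjoint (J n) (J n \<psi>)) \<longlonglongrightarrow> \<psi>" for \<psi>
      by (rule LIM_zero_cancel[OF tendsto_norm_zero_cancel[OF J_adj]])
    show "(\<lambda>n. cadjoint (J n) (resolvent (A\<^sub>n n) z (J n \<psi>))) \<longlonglongrightarrow> resolvent A z \<psi>" for \<psi>
      by (rule LIM_zero_cancel[OF tendsto_norm_zero_cancel[OF res[rule_format]]])
  qed (use assms C z z' in auto)
  \<comment> \<open>Midpoint and half-length describe the interval by
    \<open>\<bar>t - m\<bar>\<close>, the form in which the Moebius estimates are stated.\<close>
  define m d where "m = (l\<^sub>0 + l\<^sub>1) / 2" and "d = (l\<^sub>1 - l\<^sub>0) / 2"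
  have l: "l\<^sub>0 = m - d" "l\<^sub>1 = m + d" by (simp_all add: m_def d_def field_simps)
  have d: "0 < d" using assms(10) by (simp add: d_def)
  have endpoints: "P {m - d} = (\<lambda>\<psi>. 0)" "P {m + d} = (\<lambda>\<psi>. 0)"
    using assms(11,12) by (simp_all add: l)
  have open_lim: "strong_limit (\<lambda>n \<psi>. cadjoint (J n) (P\<^sub>n n {l\<^sub>0<..<l\<^sub>1} (J n \<psi>))) (P {l\<^sub>0<..<l\<^sub>1})"
    unfolding l by (rule spectral_projection_strong_limit[OF d endpoints]) auto
  moreover have "strong_limit (\<lambda>n \<psi>. cadjoint (J n) (P\<^sub>n n {l\<^sub>0..l\<^sub>1} (J n \<psi>))) (P {l\<^sub>0<..<l\<^sub>1})"
    unfolding l by (rule spectral_projection_strong_limit[OF d endpoints]) auto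
  moreover have "P {l\<^sub>0<..<l\<^sub>1} = P {l\<^sub>0..l\<^sub>1}"
    unfolding l by (rule P_open_eq_closed[OF d endpoints])
  moreover note cdim_range_le_liminf[OF open_lim] liminf_cdim_compression_le
  ultimately show ?thesis by blast
qed

end
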